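(* Let $\lambda_\varepsilon(q)=\widetilde\lambda(q/\varepsilon)$, $q\in\mathbb R$, $\varepsilon\in(0,1]$. Assume that one of the following conditions is satisfied: 1. $\widetilde\lambda(q)$ is a continuously differentiable positive 1-periodic function; 2. $\widetilde\lambda(q)$, $q\in\mathbb R$, is an ergodic stationary process, independent of the Wiener process $W_t$, with continuously differentiable trajectories and $0<\lambda_-\le\widetilde\lambda(q)\le\lambda_+<\infty$ for some constants $\lambda_-,\lambda_+$. Put $\overline\lambda=\int_0^1\widetilde\lambda(q)\,dq$ if condition 1 is satisfied, and $\overline\lambda=\mathbf E\widetilde\lambda(q)$ if condition 2 is satisfied. Let $q_t^{\mu,\delta,\varepsilon}$ be the solution of $$\mu\ddot q_t^{\mu,\delta,\varepsilon}=b(q_t^{\mu,\delta,\varepsilon})-\lambda_\varepsilon(q_t^{\mu,\delta,\varepsilon})\dot q_t^{\mu,\delta,\varepsilon}+\dot W_t^\delta,\qquad q_0^{\mu,\delta,\varepsilon}=q,\ \dot q_0^{\mu,\delta,\varepsilon}=p.$$ Then $q_t^{\mu,\delta,\varepsilon}$ converges weakly, when first $\mu\downarrow0$, then $\delta\downarrow0$, and then $\varepsilon\downarrow0$, to the process $\overline q_t$ defined by the equation $$\dot{\overline q}_t=\frac1{\overline\lambda}b(\overline q_t)+\frac1{\overline\lambda}\dot W_t,\qquad \overline q_0=q.$$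
   Context: The function $b:\mathbb R\to\mathbb R$ is continuously differentiable and bounded together with its first derivative. $W_t$ is a standard one-dimensional Wiener process and $W_t^\delta=\frac1\delta\int_0^\infty W_s\,\rho\big(\frac{s-t}{\delta}\big)ds$, where $\rho$ is a $C^\infty$ function with support in $[0,1]$ and $\int_0^1\rho(s)ds=1$; $\dot W_t^\delta$ is its time derivative. Weak convergence of processes means weak convergence of their laws (on finite time intervals); the limits in $\mu$, $\delta$, $\varepsilon$ are taken successively (iterated limits). *)

theory Defs
  imports "HOL-Probability.Probability"
begin

section \<open>Processes and their laws on path space\<close>

text \<open>Time runs over \<open>t \<ge> 0\<close>; the values of these processes at negative times are
  irrelevant throughout.\<close>

definition continuous_process :: "'a measure \<Rightarrow> (real \<Rightarrow> 'a \<Rightarrow> real) \<Rightarrow> bool" where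
  "continuous_process M X \<longleftrightarrow>
     (\<forall>t\<ge>0. X t \<in> borel_measurable M) \<and>
     (\<forall>\<omega>\<in>space M. continuous_on {0..} (\<lambda>t. X t \<omega>))"

definition wiener_process :: "'a measure \<Rightarrow> (real \<Rightarrow> 'a \<Rightarrow> real) \<Rightarrow> bool" where
  "wiener_process M W \<longleftrightarrow>
     prob_space M \<and>
     (\<forall>t\<ge>0. W t \<in> borel_measurable M) \<and>
     (AE \<omega> in M. W 0 \<omega> = 0) \<and>
     (AE \<omega> in M. continuous_on {0..} (\<lambda>t. W t \<omega>)) \<and>
     (\<forall>s t. 0 \<le> s \<longrightarrow> s < t \<longrightarrow>
        distributed M lborel (\<lambda>\<omega>. W t \<omega> - W s \<omega>) (normal_density 0 (sqrt (t - s)))) \<and>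
     (\<forall>(t :: nat \<Rightarrow> real) n. 0 \<le> t 0 \<longrightarrow> strict_mono t \<longrightarrow>
        prob_space.indep_vars M (\<lambda>_. borel) (\<lambda>i \<omega>. W (t (Suc i)) \<omega> - W (t i) \<omega>) {..<n})"

text \<open>The space \<open>C[0,T]\<close> with the topology of the supremum metric.  Its points are the
  continuous functions on \<open>{0..T}\<close>, extended by \<open>undefined\<close> outside this interval.\<close>

definition path_topology :: "real \<Rightarrow> (real \<Rightarrow> real) topology" where
  "path_topology T = mtopology_of (cfunspace (top_of_set {0..T}) euclidean_metric)"

definition topology_borel :: "'b topology \<Rightarrow> 'b measure" where
  "topology_borel X = sigma (topspace X) {U. openin X U}"

definition path_law :: "'a measure \<Rightarrow> real \<Rightarrow> (real \<Rightarrow> 'a \<Rightarrow> real) \<Rightarrow> (real \<Rightarrow> real) measure" where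
  "path_law M T X = distr M (topology_borel (path_topology T)) (\<lambda>\<omega>. \<lambda>t\<in>{0..T}. X t \<omega>)"

definition borel_probability :: "'b topology \<Rightarrow> 'b measure \<Rightarrow> bool" where
  "borel_probability X \<nu> \<longleftrightarrow> prob_space \<nu> \<and> sets \<nu> = sets (topology_borel X)"

definition weakly_converges ::
    "'b topology \<Rightarrow> ('i \<Rightarrow> 'b measure) \<Rightarrow> 'b measure \<Rightarrow> 'i filter \<Rightarrow> bool" where
  "weakly_converges X \<nu>s \<nu> F \<longleftrightarrow>
     (\<forall>\<^sub>F i in F. borel_probability X (\<nu>s i)) \<and> borel_probability X \<nu> \<and>
     (\<forall>f. continuous_map X euclideanreal f \<and> bounded (f ` topspace X) \<longrightarrow>
        ((\<lambda>i. \<integral>x. f x \<partial>\<nu>s i) \<longlongrightarrow> (\<integral>x. f x \<partial>\<nu>)) F)"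

text \<open>Weak convergence on every finite time interval, when first \<open>\<mu> \<down> 0\<close>, then \<open>\<delta> \<down> 0\<close>, then
  \<open>\<epsilon> \<down> 0\<close>: every inner limit exists as a probability law on \<open>C[0,T]\<close>.\<close>

definition iterated_weak_limit ::
    "'a measure \<Rightarrow> (real \<Rightarrow> real \<Rightarrow> real \<Rightarrow> real \<Rightarrow> 'a \<Rightarrow> real) \<Rightarrow> (real \<Rightarrow> 'a \<Rightarrow> real) \<Rightarrow> bool" where
  "iterated_weak_limit M X Y \<longleftrightarrow>
     (\<forall>T>0. \<exists>(\<nu>1 :: real \<Rightarrow> real \<Rightarrow> (real \<Rightarrow> real) measure) (\<nu>2 :: real \<Rightarrow> (real \<Rightarrow> real) measure).
        (\<forall>\<epsilon>\<in>{0<..1}. \<forall>\<delta>>0.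
           weakly_converges (path_topology T) (\<lambda>\<mu>. path_law M T (X \<mu> \<delta> \<epsilon>)) (\<nu>1 \<delta> \<epsilon>) (at_right 0)) \<and>
        (\<forall>\<epsilon>\<in>{0<..1}.
           weakly_converges (path_topology T) (\<lambda>\<delta>. \<nu>1 \<delta> \<epsilon>) (\<nu>2 \<epsilon>) (at_right 0)) \<and>
        weakly_converges (path_topology T) \<nu>2 (path_law M T Y) (at_right 0))"

section \<open>The mollified Wiener process\<close>

definition mollifier :: "(real \<Rightarrow> real) \<Rightarrow> bool" where
  "mollifier \<rho> \<longleftrightarrow>
     (\<forall>n x. (deriv ^^ n) \<rho> differentiable (at x)) \<and>
     (\<forall>x. x \<notin> {0..1} \<longrightarrow> \<rho> x = 0) \<and>
     integral {0..1} \<rho> = 1"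

definition mollified ::
    "(real \<Rightarrow> real) \<Rightarrow> real \<Rightarrow> (real \<Rightarrow> 'a \<Rightarrow> real) \<Rightarrow> real \<Rightarrow> 'a \<Rightarrow> real" where
  "mollified \<rho> \<delta> W t \<omega> = 1 / \<delta> * (LBINT s:{0..}. W s \<omega> * \<rho> ((s - t) / \<delta>))"

section \<open>Friction coefficients\<close>

definition periodic_friction :: "(real \<Rightarrow> real) \<Rightarrow> bool" where
  "periodic_friction l \<longleftrightarrow>
     l C1_differentiable_on UNIV \<and> (\<forall>x. 0 < l x) \<and> (\<forall>x. l (x + 1) = l x)"

text \<open>The space \<open>C(\<real>)\<close> with the sigma-algebra generated by the coordinate maps.\<close>

definition trajectory_space :: "(real \<Rightarrow> real) measure" where
  "trajectory_space = restrict_space (Pi\<^sub>M UNIV (\<lambda>_. borel)) {x. continuous_on UNIV x}"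

definition stationary_process :: "'a measure \<Rightarrow> (real \<Rightarrow> 'a \<Rightarrow> real) \<Rightarrow> bool" where
  "stationary_process M X \<longleftrightarrow>
     (\<forall>h. distr M trajectory_space (\<lambda>\<omega> x. X (x + h) \<omega>) = distr M trajectory_space (\<lambda>\<omega> x. X x \<omega>))"

text \<open>Shift-invariant events are taken in \<open>C(\<real>)\<close>, not in the full product space
  \<open>\<real> \<rightarrow> \<real>\<close>: there a measurable set depends on countably many coordinates only, so the strictly
  shift-invariant measurable sets are trivial and the condition would be void.\<close>

definition ergodic_process :: "'a measure \<Rightarrow> (real \<Rightarrow> 'a \<Rightarrow> real) \<Rightarrow> bool" where
  "ergodic_process M X \<longleftrightarrow>
     (\<forall>A\<in>sets trajectory_space.
        (\<forall>x\<in>space trajectory_space. \<forall>h. (\<lambda>s. x (s + h)) \<in> A \<longleftrightarrow> x \<in> A) \<longrightarrow>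
        measure M {\<omega> \<in> space M. (\<lambda>x. X x \<omega>) \<in> A} \<in> {0, 1})"

definition random_friction ::
    "'a measure \<Rightarrow> (real \<Rightarrow> 'a \<Rightarrow> real) \<Rightarrow> (real \<Rightarrow> 'a \<Rightarrow> real) \<Rightarrow> bool" where
  "random_friction M W lam \<longleftrightarrow>
     (\<forall>x. lam x \<in> borel_measurable M) \<and>
     (\<forall>\<omega>\<in>space M. (\<lambda>x. lam x \<omega>) C1_differentiable_on UNIV) \<and>
     stationary_process M lam \<and> ergodic_process M lam \<and>
     prob_space.indep_var M
       (Pi\<^sub>M UNIV (\<lambda>_. borel)) (\<lambda>\<omega> x. lam x \<omega>)
       (Pi\<^sub>M {0..} (\<lambda>_. borel)) (\<lambda>\<omega>. \<lambda>t\<in>{0..}. W t \<omega>) \<and>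
     (\<exists>l1 l2. 0 < l1 \<and> (\<forall>\<omega>\<in>space M. \<forall>x. l1 \<le> lam x \<omega> \<and> lam x \<omega> \<le> l2))"

section \<open>The equations\<close>

text \<open>Second-order equation \<open>\<mu> x'' = b(x) - l(x) x' + f\<close> with initial position \<open>q\<close> and initial
  velocity \<open>p\<close>; derivatives at time \<open>0\<close> are one-sided.\<close>

definition langevin_solution ::
    "real \<Rightarrow> (real \<Rightarrow> real) \<Rightarrow> (real \<Rightarrow> real) \<Rightarrow> (real \<Rightarrow> real) \<Rightarrow> real \<Rightarrow> real \<Rightarrow> (real \<Rightarrow> real) \<Rightarrow> bool"
  where
  "langevin_solution \<mu> b l f q p x \<longleftrightarrow>
     (\<exists>v a. (\<forall>t\<ge>0. (x has_real_derivative v t) (at t within {0..}) \<and>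
                   (v has_real_derivative a t) (at t within {0..}) \<and>
                   \<mu> * a t = b (x t) - l (x t) * v t + f t) \<and>
            x 0 = q \<and> v 0 = p)"

text \<open>\<open>dx = (1/L) b(x) dt + (1/L) dw\<close> with constant \<open>L\<close>, in integrated form: the noise is
  additive, so the equation is meaningful path by path.\<close>

definition averaged_solution ::
    "(real \<Rightarrow> real) \<Rightarrow> real \<Rightarrow> (real \<Rightarrow> real) \<Rightarrow> real \<Rightarrow> (real \<Rightarrow> real) \<Rightarrow> bool" where
  "averaged_solution b L w q x \<longleftrightarrow>
     (\<forall>t\<ge>0. x t = q + 1 / L * integral {0..t} (\<lambda>s. b (x s)) + 1 / L * w t)"

end

theory Submission
  imports Defs
begin

text \<open>The additive noise makes everything pathwise. With \<open>\<Lambda>\<close> a primitive of the unscaled friction and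
  \<open>L\<^sub>\<epsilon>(x) = \<epsilon> \<Lambda>(x/\<epsilon>)\<close>, a primitive of \<open>\<lambda>\<^sub>\<epsilon>\<close>, integrating the Langevin equation in time gives
  \<open>L\<^sub>\<epsilon>(x\<^sub>t) - L\<^sub>\<epsilon>(q) = \<integral>\<^sub>0\<^sup>t b(x\<^sub>s) ds + W\<^sup>\<delta>\<^sub>t - W\<^sup>\<delta>\<^sub>0 - \<mu>(v\<^sub>t - p)\<close>. Friction bounded below keeps the velocity
  \<open>v\<close> bounded uniformly in \<open>\<mu>\<close>, and \<open>L\<^sub>\<epsilon>\<close> expands distances, so by Gronwall's inequality the solution of
  such an integral equation depends Lipschitz-continuously on the forcing in the uniform norm. This gives the
  limits \<open>\<mu> \<down> 0\<close> and \<open>\<delta> \<down> 0\<close>. In the last limit \<open>L\<^sub>\<epsilon>(x)\<close> tends to the mean friction times \<open>x\<close> locally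
  uniformly, by periodicity or by the ergodic theorem, and the difference is again a small perturbation of the
  forcing. All limits hold almost surely in the uniform norm along every sequence of parameters,
  which implies weak convergence.\<close>

section \<open>Integral equations with additive forcing\<close>

text \<open>The equation is never solved for the velocity: dividing by the friction would make the
  noise multiplicative and call for stochastic integrals. Kept under \<open>L\<close>, the noise
  stays additive, and the quantity that gets averaged is the friction itself, so its arithmetic mean
  appears in the limit and not the mean of its inverse. The bound on the velocity involves the
  maximum of the derivative of the mollified path, which is not controlled as \<delta> tends to 0;
  this ties the argument to taking \<mu> to 0 with \<delta> fixed. Each equation holds outside a
  null set that may depend on the parameters. Sequences of parameters are used because only
  countably many null sets can be discarded. The inner limit laws are not given. They are produced
  as laws of processes on the same probability space, and each limit passes on the integral equation
  of its process, not only the law. Ergodicity concerns the flow of all real shifts, while Birkhoff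
  sums iterate a single shift, which need not be ergodic. The zero-one property is therefore invoked
  only for events invariant under the whole flow.\<close>

lemma gronwall:
  fixes u :: "real \<Rightarrow> real"
  assumes cont: "continuous_on {0..T} u" and "0 \<le> K"
    and le: "\<And>t. t \<in> {0..T} \<Longrightarrow> u t \<le> a + K * integral {0..t} u"
    and t: "t \<in> {0..T}"
  shows "u t \<le> a * exp (K * t)"
proof -
  define U where "U = (\<lambda>s. integral {0..s} u)"
  have dU: "(U has_real_derivative u s) (at s within {0..T})" if "s \<in> {0..T}" for s
    unfolding U_def using integral_has_real_derivative[OF cont that] .
  \<comment> \<open>Integrating factor: the sign of the derivative of \<open>h\<close> is that of
    \<open>u - (a + K * U)\<close>, which the hypothesis makes nonpositive.\<close>
  define h where "h = (\<lambda>s. exp (- K * s) * (a + K * U s))"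
  have dh: "(h has_real_derivative K * exp (- K * s) * (u s - (a + K * U s))) (at s within {0..T})"
    if "s \<in> {0..T}" for s
    unfolding h_def by (auto intro!: derivative_eq_intros dU that simp: algebra_simps)
  have "h t \<le> h 0"
  proof (rule DERIV_nonpos_imp_decreasing_open[of 0 t h])
    show "0 \<le> t" using t by simp
    show "\<exists>y. (h has_real_derivative y) (at s) \<and> y \<le> 0" if "0 < s" "s < t" for s
    proof (intro exI conjI)
      show "(h has_real_derivative K * exp (- K * s) * (u s - (a + K * U s))) (at s)"
        using dh[of s] that t by (simp add: at_within_Icc_at)
      show "K * exp (- K * s) * (u s - (a + K * U s)) \<le> 0"
        using le[of s] that t \<open>0 \<le> K\<close> unfolding U_def
        by (intro mult_nonneg_nonpos mult_nonneg_nonneg) auto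
    qed
    show "continuous_on {0..t} h"
      by (rule DERIV_continuous_on, rule DERIV_subset[OF dh]) (use t in auto)
  qed
  then have "exp (- K * t) * (a + K * U t) \<le> a" by (simp add: h_def U_def)
  then have "exp (K * t) * (exp (- K * t) * (a + K * U t)) \<le> exp (K * t) * a"
    by (intro mult_left_mono) auto
  then have "a + K * U t \<le> a * exp (K * t)"
    by (simp add: mult.assoc[symmetric] exp_add[symmetric] mult.commute)
  with le[OF t] show ?thesis by (simp add: U_def)
qed

text \<open>Friction enters through a primitive \<open>L\<close> and noise through its values, not
  its derivative. One notion thus covers the Langevin equation with its inertia moved into
  \<open>F\<close>, the equation driven by a Wiener path, and, for linear \<open>L\<close>, the
  averaged equation. The initial value is implicit: at time 0 the identity reads
  \<open>L (x 0) - L q = F 0\<close>.\<close>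

definition integral_solution ::
    "(real \<Rightarrow> real) \<Rightarrow> (real \<Rightarrow> real) \<Rightarrow> real \<Rightarrow> (real \<Rightarrow> real) \<Rightarrow> (real \<Rightarrow> real) \<Rightarrow> bool" where
  "integral_solution b L q F x \<longleftrightarrow> continuous_on {0..} x \<and>
     (\<forall>t\<ge>0. L (x t) - L q = integral {0..t} (\<lambda>s. b (x s)) + F t)"

text \<open>Subtracting the two equations controls \<open>L (x1 s) - L (x2 s)\<close>; expansivity
  of \<open>L\<close> turns this into control of \<open>x1 s - x2 s\<close>, and Gronwall applies.
  The bound sees \<open>L\<close> only through \<open>c\<close>, and neither forcing has to be
  continuous.\<close>

lemma integral_solution_stable:
  fixes b L F1 F2 x1 x2 :: "real \<Rightarrow> real"
  assumes "0 < c" and L: "\<And>x y. c * \<bar>x - y\<bar> \<le> \<bar>L x - L y\<bar>"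
    and "0 \<le> K" and b: "\<And>x y. \<bar>b x - b y\<bar> \<le> K * \<bar>x - y\<bar>" and cb: "continuous_on UNIV b"
    and x1: "integral_solution b L q F1 x1" and x2: "integral_solution b L q F2 x2"
    and F: "\<And>t. t \<in> {0..T} \<Longrightarrow> \<bar>F1 t - F2 t\<bar> \<le> r"
    and t: "t \<in> {0..T}"
  shows "\<bar>x1 t - x2 t\<bar> \<le> r / c * exp (K / c * T)"
proof -
  have c: "continuous_on {0..s} x1" "continuous_on {0..s} x2" for s
    using x1 x2 by (auto simp: integral_solution_def intro: continuous_on_subset)
  have cbx: "continuous_on {0..s} (\<lambda>u. b (x1 u))" "continuous_on {0..s} (\<lambda>u. b (x2 u))" for s
    by (auto intro!: continuous_on_compose2[OF cb] c)
  have "\<bar>x1 s - x2 s\<bar> \<le> r / c + K / c * integral {0..s} (\<lambda>u. \<bar>x1 u - x2 u\<bar>)"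
    if s: "s \<in> {0..T}" for s
  proof -
    have "\<bar>integral {0..s} (\<lambda>u. b (x1 u)) - integral {0..s} (\<lambda>u. b (x2 u))\<bar>
        = \<bar>integral {0..s} (\<lambda>u. b (x1 u) - b (x2 u))\<bar>"
      by (subst integral_diff) (auto intro!: integrable_continuous_real cbx)
    also have "\<dots> \<le> integral {0..s} (\<lambda>u. K * \<bar>x1 u - x2 u\<bar>)"
      unfolding real_norm_def[symmetric]
      by (rule integral_norm_bound_integral)
        (auto intro!: integrable_continuous_real continuous_intros cbx c b)
    finally have I: "\<bar>integral {0..s} (\<lambda>u. b (x1 u)) - integral {0..s} (\<lambda>u. b (x2 u))\<bar>
        \<le> K * integral {0..s} (\<lambda>u. \<bar>x1 u - x2 u\<bar>)" by simp
    have "L (x1 s) - L q = integral {0..s} (\<lambda>u. b (x1 u)) + F1 s"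
      "L (x2 s) - L q = integral {0..s} (\<lambda>u. b (x2 u)) + F2 s"
      using x1 x2 s by (auto simp: integral_solution_def)
    with I F[OF s] L[of "x1 s" "x2 s"]
    have "c * \<bar>x1 s - x2 s\<bar> \<le> r + K * integral {0..s} (\<lambda>u. \<bar>x1 u - x2 u\<bar>)" by linarith
    then show ?thesis using \<open>0 < c\<close> by (simp add: field_simps)
  qed
  then have "\<bar>x1 t - x2 t\<bar> \<le> r / c * exp (K / c * t)"
    by (rule gronwall[rotated 2]) (use assms in \<open>auto intro!: continuous_intros c\<close>)
  also have "0 \<le> r" using F[OF t] by linarith
  then have "r / c * exp (K / c * t) \<le> r / c * exp (K / c * T)"
    using t assms by (intro mult_left_mono) (auto intro!: mult_left_mono divide_right_mono)
  finally show ?thesis .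
qed

lemma integral_solution_tendsto:
  fixes b L F x :: "real \<Rightarrow> real" and Fs xs :: "nat \<Rightarrow> real \<Rightarrow> real"
  assumes "0 < c" and L: "\<And>x y. c * \<bar>x - y\<bar> \<le> \<bar>L x - L y\<bar>"
    and "0 \<le> K" and b: "\<And>x y. \<bar>b x - b y\<bar> \<le> K * \<bar>x - y\<bar>" and cb: "continuous_on UNIV b"
    and xs: "\<And>n. integral_solution b L q (Fs n) (xs n)" and x: "integral_solution b L q F x"
    and F: "uniform_limit {0..T} Fs F sequentially"
  shows "uniform_limit {0..T} xs x sequentially"
proof (rule uniform_limitI)
  fix e :: real assume "0 < e"
  \<comment> \<open>Chosen so that the stability estimate returns exactly
    \<open>e / 2\<close>.\<close>
  define r where "r = e / 2 * c / exp (K / c * T)"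
  have "r > 0" using \<open>0 < e\<close> \<open>0 < c\<close> by (simp add: r_def)
  have re: "r / c * exp (K / c * T) < e" using \<open>0 < e\<close> \<open>0 < c\<close> by (simp add: r_def)
  from uniform_limitD[OF F \<open>r > 0\<close>]
  show "\<forall>\<^sub>F n in sequentially. \<forall>t\<in>{0..T}. dist (xs n t) (x t) < e"
  proof eventually_elim
    case (elim n)
    have "\<bar>xs n t - x t\<bar> \<le> r / c * exp (K / c * T)" if "t \<in> {0..T}" for t
      by (rule integral_solution_stable[OF assms(1-5) xs[of n] x])
        (use elim that in \<open>auto simp: dist_real_def less_imp_le\<close>)
    with re show ?case by (force simp: dist_real_def)
  qed
qed

text \<open>This supplies existence for the limiting forcing. Stability applied to two members of
  the sequence makes the solutions uniformly Cauchy on every \<open>{0..T}\<close>, and every term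
  of the equation passes to the uniform limit.\<close>

lemma integral_solution_limit:
  fixes b L F :: "real \<Rightarrow> real" and Fs xs :: "nat \<Rightarrow> real \<Rightarrow> real"
  assumes "0 < c" and L: "\<And>x y. c * \<bar>x - y\<bar> \<le> \<bar>L x - L y\<bar>" and cL: "continuous_on UNIV L"
    and "0 \<le> K" and b: "\<And>x y. \<bar>b x - b y\<bar> \<le> K * \<bar>x - y\<bar>" and cb: "continuous_on UNIV b"
    and xs: "\<And>n. integral_solution b L q (Fs n) (xs n)"
    and F: "\<And>T. uniform_limit {0..T} Fs F sequentially"
  shows "integral_solution b L q F (\<lambda>t. lim (\<lambda>n. xs n t))"
proof -
  have cx: "continuous_on {0..T} (xs n)" for n T
    using xs[of n] by (auto simp: integral_solution_def intro: continuous_on_subset)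
  have "uniformly_Cauchy_on {0..T} xs" for T
  proof (rule uniformly_Cauchy_onI)
    fix e :: real assume "0 < e"
    define r where "r = e / 2 * c / exp (K / c * T)"
    have "r > 0" using \<open>0 < e\<close> \<open>0 < c\<close> by (simp add: r_def)
    have re: "r / c * exp (K / c * T) < e" using \<open>0 < e\<close> \<open>0 < c\<close> by (simp add: r_def)
    from F have "uniformly_Cauchy_on {0..T} Fs"
      unfolding uniformly_convergent_eq_Cauchy[symmetric] by (rule uniformly_convergentI)
    from this[unfolded uniformly_Cauchy_on_def, rule_format, OF \<open>r > 0\<close>] obtain N where
      N: "\<forall>t\<in>{0..T}. \<forall>m\<ge>N. \<forall>n\<ge>N. dist (Fs m t) (Fs n t) < r" by blast
    have "\<bar>xs m t - xs n t\<bar> \<le> r / c * exp (K / c * T)" if "t \<in> {0..T}" "m \<ge> N" "n \<ge> N" for t m n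
      by (rule integral_solution_stable[OF assms(1,2,4-6) xs[of m] xs[of n]])
        (use N that in \<open>auto simp: dist_real_def intro: less_imp_le\<close>)
    with re show "\<exists>N. \<forall>t\<in>{0..T}. \<forall>m\<ge>N. \<forall>n\<ge>N. dist (xs m t) (xs n t) < e"
      by (intro exI[of _ N]) (force simp: dist_real_def)
  qed
  then have "uniformly_convergent_on {0..T} xs" for T
    using uniformly_convergent_eq_Cauchy by blast
  then have ul: "uniform_limit {0..T} xs (\<lambda>t. lim (\<lambda>n. xs n t)) sequentially" for T
    by (simp add: uniformly_convergent_uniform_limit_iff)
  let ?x = "\<lambda>t. lim (\<lambda>n. xs n t)"
  have cl: "continuous_on {0..T} ?x" for T
    by (rule uniform_limit_theorem[OF _ ul]) (auto intro: always_eventually cx)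
  show ?thesis
    unfolding integral_solution_def
  proof (intro conjI allI impI)
    show "continuous_on {0..} ?x"
      unfolding continuous_on_eq_continuous_within
    proof
      fix t :: real assume "t \<in> {0..}"
      then have "continuous (at t within {0..t+1}) ?x"
        using cl[of "t + 1"] by (auto simp: continuous_on_eq_continuous_within)
      \<comment> \<open>Convergence is uniform only on bounded intervals; continuity on the
        half-line is local, and the margin 1 makes \<open>t\<close> interior on the right.\<close>
      moreover have "at t within {0..} = at t within {0..t+1}"
        by (rule at_within_nhd[where S="{..<t+1}"]) auto
      ultimately show "continuous (at t within {0..}) ?x" by (simp add: continuous_within)
    qed
    fix t :: real assume t: "0 \<le> t"
    have lim: "(\<lambda>n. xs n t) \<longlonglongrightarrow> ?x t"
      by (rule tendsto_uniform_limitI[OF ul[of t]]) (use t in auto)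
    have lF: "(\<lambda>n. Fs n t) \<longlonglongrightarrow> F t"
      by (rule tendsto_uniform_limitI[OF F[of t]]) (use t in auto)
    have "uniform_limit {0..t} (\<lambda>n s. b (xs n s)) (\<lambda>s. b (?x s)) sequentially"
    proof (rule uniform_limit_compose_uniformly_continuous_on[OF ul])
      show "uniformly_continuous_on UNIV b"
        by (rule lipschitz_on_uniformly_continuous[of K], rule lipschitz_onI)
          (use b \<open>0 \<le> K\<close> in \<open>auto simp: dist_real_def\<close>)
    qed auto
    then obtain I J where I: "\<And>n. ((\<lambda>s. b (xs n s)) has_integral I n) {0..t}"
        and J: "((\<lambda>s. b (?x s)) has_integral J) {0..t}" and "I \<longlonglongrightarrow> J"
      by (rule uniform_limit_integral) (auto intro!: continuous_on_compose2[OF cb] cx)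
    then have "(\<lambda>n. integral {0..t} (\<lambda>s. b (xs n s))) \<longlonglongrightarrow> integral {0..t} (\<lambda>s. b (?x s))"
      unfolding integral_unique[OF I] integral_unique[OF J] by simp
    from tendsto_add[OF this lF]
    have "(\<lambda>n. L (xs n t) - L q) \<longlonglongrightarrow> integral {0..t} (\<lambda>s. b (?x s)) + F t"
      using xs t by (simp add: integral_solution_def)
    moreover have "(\<lambda>n. L (xs n t) - L q) \<longlonglongrightarrow> L (?x t) - L q"
      using cL lim by (auto intro!: tendsto_intros
          isCont_tendsto_compose[of _ L] simp: continuous_on_eq_continuous_at)
    ultimately show "L (?x t) - L q = integral {0..t} (\<lambda>s. b (?x s)) + F t"
      using LIMSEQ_unique by blast
  qed
qed

section \<open>Primitives and mean value bounds\<close>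

definition primitive :: "(real \<Rightarrow> real) \<Rightarrow> real \<Rightarrow> real" where
  "primitive l = (SOME L. L 0 = 0 \<and> (\<forall>x. (L has_real_derivative l x) (at x)))"

text \<open>Choosing an antiderivative on the whole line avoids oriented integrals at negative
  arguments; the normalisation at 0 makes the choice unique.\<close>

lemma primitive:
  assumes "continuous_on UNIV l"
  shows primitive_0: "primitive l 0 = 0"
    and DERIV_primitive: "(primitive l has_real_derivative l x) (at x)"
proof -
  have "isCont l x" for x using assms by (simp add: continuous_on_eq_continuous_at)
  then obtain F where F: "\<And>x. (F has_real_derivative l x) (at x)"
    using einterval_antiderivative[of "-\<infinity>" "\<infinity>" l]
    by (auto simp: has_real_derivative_iff_has_vector_derivative)
  have "\<exists>L. L 0 = 0 \<and> (\<forall>x. (L has_real_derivative l x) (at x))"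
    by (rule exI[of _ "\<lambda>x. F x - F 0"]) (auto intro!: derivative_eq_intros F)
  from someI_ex[OF this] show "primitive l 0 = 0" "(primitive l has_real_derivative l x) (at x)"
    by (auto simp: primitive_def)
qed

lemma primitive_unique:
  assumes L: "\<And>x. (L has_real_derivative l x) (at x)" and l: "continuous_on UNIV l"
  shows "primitive l x = L x - L 0"
proof -
  have "((\<lambda>x. primitive l x - L x) has_real_derivative 0) (at y)" for y
    by (auto intro!: derivative_eq_intros L DERIV_primitive l)
  then have "primitive l x - L x = primitive l 0 - L 0"
    using DERIV_isconst_all[of "\<lambda>x. primitive l x - L x"] by blast
  then show ?thesis by (simp add: primitive_0[OF l])
qed

lemma DERIV_expansive:
  fixes L :: "real \<Rightarrow> real"
  assumes L: "\<And>x. (L has_real_derivative l x) (at x)" and l: "\<And>x. c \<le> l x" and "0 \<le> c"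
  shows "c * \<bar>x - y\<bar> \<le> \<bar>L x - L y\<bar>"
proof -
  have *: "c * (y - x) \<le> L y - L x" if "x < y" for x y
  proof -
    have "\<exists>z>x. z < y \<and> L y - L x = (y - x) * l z" by (rule MVT2[OF that]) (rule L)
    then obtain z where "L y - L x = (y - x) * l z" by blast
    then show ?thesis using l[of z] that by (simp add: mult.commute mult_left_mono)
  qed
  show ?thesis using *[of x y] *[of y x] by (cases x y rule: linorder_cases) auto
qed

lemma DERIV_lipschitz:
  fixes L :: "real \<Rightarrow> real"
  assumes L: "\<And>x. (L has_real_derivative l x) (at x)" and l: "\<And>x. \<bar>l x\<bar> \<le> K"
  shows "\<bar>L x - L y\<bar> \<le> K * \<bar>x - y\<bar>"
proof -
  have *: "\<bar>L y - L x\<bar> \<le> K * (y - x)" if "x < y" for x y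
  proof -
    have "\<exists>z>x. z < y \<and> L y - L x = (y - x) * l z" by (rule MVT2[OF that]) (rule L)
    then obtain z where "L y - L x = (y - x) * l z" by blast
    then show ?thesis using l[of z] that by (simp add: abs_mult mult.commute mult_left_mono)
  qed
  show ?thesis using *[of x y] *[of y x] by (cases x y rule: linorder_cases) auto
qed

text \<open>At a maximum of \<open>v\<^sup>2\<close> over \<open>[0, t]\<close> that is not attained at time \<open>0\<close> the derivative
  \<open>2 v a\<close> is nonnegative, so the friction term cannot exceed the forcing.\<close>

lemma langevin_velocity_bounded:
  fixes v a g k :: "real \<Rightarrow> real"
  assumes "0 < \<mu>" "0 < c"
    and v: "\<And>t. 0 \<le> t \<Longrightarrow> (v has_real_derivative a t) (at t within {0..})"
    and eq: "\<And>t. 0 \<le> t \<Longrightarrow> \<mu> * a t = g t - k t * v t"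
    and k: "\<And>t. c \<le> k t" and g: "\<And>t. t \<in> {0..T} \<Longrightarrow> \<bar>g t\<bar> \<le> C"
    and t: "t \<in> {0..T}"
  shows "\<bar>v t\<bar> \<le> \<bar>v 0\<bar> + C / c"
proof -
  have "0 \<le> C" using g[OF t] by linarith
  have "continuous_on {0..} v" using v by (intro DERIV_continuous_on[of _ _ a]) auto
  then have "continuous_on {0..t} (\<lambda>s. (v s)\<^sup>2)"
    by (auto intro!: continuous_intros intro: continuous_on_subset)
  moreover have "{0..t} \<noteq> {}" using t by simp
  ultimately obtain s where s: "s \<in> {0..t}" "\<And>r. r \<in> {0..t} \<Longrightarrow> (v r)\<^sup>2 \<le> (v s)\<^sup>2"
    using continuous_attains_sup[of "{0..t}" "\<lambda>s. (v s)\<^sup>2"] by blast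
  have "\<bar>v s\<bar> \<le> \<bar>v 0\<bar> + C / c"
  proof (cases "s = 0")
    case True
    then show ?thesis using \<open>0 \<le> C\<close> \<open>0 < c\<close> by simp
  next
    case False
    then have "0 < s" using s by auto
    have d: "((\<lambda>s. (v s)\<^sup>2) has_real_derivative 2 * v s * a s) (at s within {0..})"
      using \<open>0 < s\<close> by (auto intro!: derivative_eq_intros v)
    have "0 \<le> 2 * v s * a s"
    proof (rule ccontr)
      assume "\<not> 0 \<le> 2 * v s * a s"
      \<comment> \<open>A negative derivative would make the square larger just to the left of
        \<open>s\<close>, against maximality. Only the left side is used, because \<open>s\<close>
        may be the right endpoint \<open>t\<close>, where the derivative need not vanish.\<close>
      then obtain e where "0 < e" "\<And>h. 0 < h \<Longrightarrow> s - h \<in> {0..} \<Longrightarrow> h < e \<Longrightarrow> (v s)\<^sup>2 < (v (s - h))\<^sup>2"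
        using has_real_derivative_neg_dec_left[OF d] by auto
      from this(2)[of "min s e / 2"] \<open>0 < e\<close> \<open>0 < s\<close> s(2)[of "s - min s e / 2"] s(1)
      show False by (force simp: min_def split: if_splits)
    qed
    \<comment> \<open>Only the sign of the inertial term matters from here on, so the final bound is
      free of \<mu>.\<close>
    then have "0 \<le> v s * (\<mu> * a s)" using \<open>0 < \<mu>\<close>
      by (auto simp: zero_le_mult_iff mult_le_0_iff)
    then have "k s * (v s)\<^sup>2 \<le> g s * v s"
      using eq[of s] \<open>0 < s\<close> by (simp add: algebra_simps power2_eq_square)
    also have "\<dots> \<le> \<bar>g s\<bar> * \<bar>v s\<bar>" by (metis abs_ge_self abs_mult)
    also have "\<dots> \<le> C * \<bar>v s\<bar>" using g[of s] s t by (intro mult_right_mono) auto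
    finally have "k s * (v s)\<^sup>2 \<le> C * \<bar>v s\<bar>" .
    moreover have "c * (v s)\<^sup>2 \<le> k s * (v s)\<^sup>2" using k by (intro mult_right_mono) auto
    ultimately have "(c * \<bar>v s\<bar>) * \<bar>v s\<bar> \<le> C * \<bar>v s\<bar>" by (simp add: power2_eq_square mult.assoc)
    then have "c * \<bar>v s\<bar> \<le> C" using \<open>0 \<le> C\<close> by (cases "v s = 0") (auto simp: mult_le_cancel_right)
    then have "\<bar>v s\<bar> \<le> C / c" using \<open>0 < c\<close> by (simp add: field_simps)
    then show ?thesis by linarith
  qed
  moreover have "\<bar>v t\<bar> \<le> \<bar>v s\<bar>" using s(2)[of t] t by (simp add: abs_le_square_iff)
  ultimately show ?thesis by linarith
qed

text \<open>The same path \<open>x\<close> is read as a solution of the first-order equation: the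
  inertial term integrates to \<open>\<mu> * (v t - p)\<close> and is charged to the forcing, where
  the velocity bound makes it of order \<mu>.\<close>

lemma langevin_integral_solution:
  fixes b l L F f x :: "real \<Rightarrow> real"
  assumes x: "langevin_solution \<mu> b l f q p x" and "0 < \<mu>" "0 < c"
    and L: "\<And>y. (L has_real_derivative l y) (at y)" and l: "\<And>y. c \<le> l y"
    and F: "\<And>t. 0 \<le> t \<Longrightarrow> (F has_real_derivative f t) (at t)"
    and f: "\<And>t T. t \<in> {0..T} \<Longrightarrow> \<bar>f t\<bar> \<le> C T" and B: "\<And>y. \<bar>b y\<bar> \<le> B"
  obtains G where "integral_solution b L q G x"
    and "\<And>t T. t \<in> {0..T} \<Longrightarrow> \<bar>G t - (F t - F 0)\<bar> \<le> \<mu> * (2 * \<bar>p\<bar> + (B + C T) / c)"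
proof -
  obtain v a where
    xv: "\<And>t. 0 \<le> t \<Longrightarrow> (x has_real_derivative v t) (at t within {0..})" and
    va: "\<And>t. 0 \<le> t \<Longrightarrow> (v has_real_derivative a t) (at t within {0..})" and
    eq: "\<And>t. 0 \<le> t \<Longrightarrow> \<mu> * a t = b (x t) - l (x t) * v t + f t" and
    x0: "x 0 = q" "v 0 = p"
    using x unfolding langevin_solution_def by blast
  define G where "G t = F t - F 0 - \<mu> * (v t - p)" for t
  have cx: "continuous_on {0..} x" using xv by (intro DERIV_continuous_on[of _ _ v]) auto
  have "L (x t) - L q = integral {0..t} (\<lambda>s. b (x s)) + G t" if "0 \<le> t" for t
  proof -
    \<comment> \<open>In this combination the friction and noise terms of the equation cancel, which
      leaves only the drift as derivative.\<close>
    have D: "((\<lambda>s. \<mu> * v s + L (x s) - F s) has_real_derivative b (x s)) (at s within {0..t})"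
      if "0 \<le> s" for s
    proof (rule DERIV_subset)
      have "((\<lambda>s. L (x s)) has_real_derivative l (x s) * v s) (at s within {0..})"
        by (rule DERIV_chain2[OF L xv[OF that]])
      moreover have "(F has_real_derivative f s) (at s within {0..})"
        using F[OF that] by (rule DERIV_subset) simp
      ultimately have "((\<lambda>s. \<mu> * v s + L (x s) - F s) has_real_derivative
          \<mu> * a s + l (x s) * v s - f s) (at s within {0..})"
        using va[OF that] by (auto intro!: derivative_eq_intros)
      then show "((\<lambda>s. \<mu> * v s + L (x s) - F s) has_real_derivative b (x s)) (at s within {0..})"
        using eq[OF that] by simp
    qed auto
    have "((\<lambda>s. b (x s)) has_integral
        (\<mu> * v t + L (x t) - F t) - (\<mu> * v 0 + L (x 0) - F 0)) {0..t}"
      using that D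
      by (intro fundamental_theorem_of_calculus)
        (auto simp: has_real_derivative_iff_has_vector_derivative[symmetric])
    then show ?thesis by (simp add: G_def x0 integral_unique algebra_simps)
  qed
  then have 1: "integral_solution b L q G x" by (simp add: integral_solution_def cx)
  have 2: "\<bar>G t - (F t - F 0)\<bar> \<le> \<mu> * (2 * \<bar>p\<bar> + (B + C T) / c)" if t: "t \<in> {0..T}" for t T
  proof -
    have "\<bar>v t\<bar> \<le> \<bar>v 0\<bar> + (B + C T) / c"
    proof (rule langevin_velocity_bounded[OF \<open>0 < \<mu>\<close> \<open>0 < c\<close> va _ _ _ t])
      show "\<mu> * a s = (b (x s) + f s) - l (x s) * v s" if "0 \<le> s" for s using eq[OF that] by simp
      show "\<bar>b (x s) + f s\<bar> \<le> B + C T" if "s \<in> {0..T}" for s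
        using B[of "x s"] f[OF that] by linarith
    qed (use l in auto)
    \<comment> \<open>One \<open>\<bar>p\<bar>\<close> is the initial velocity in the a priori
      bound, the other comes from subtracting \<open>p\<close>.\<close>
    then have "\<bar>v t - p\<bar> \<le> 2 * \<bar>p\<bar> + (B + C T) / c" using x0 by linarith
    then show ?thesis using \<open>0 < \<mu>\<close> by (simp add: G_def abs_mult)
  qed
  show thesis by (rule that[OF 1 2])
qed

section \<open>Mollified Wiener paths\<close>

lemma mollifierD:
  assumes "mollifier \<rho>"
  shows "(\<rho> has_real_derivative deriv \<rho> x) (at x)" "continuous_on UNIV \<rho>"
    "continuous_on UNIV (deriv \<rho>)" "x \<notin> {0..1} \<Longrightarrow> \<rho> x = 0" "integral {0..1} \<rho> = 1"
proof -
  have d: "(deriv ^^ n) \<rho> differentiable (at x)" for n x using assms by (simp add: mollifier_def)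
  show "(\<rho> has_real_derivative deriv \<rho> x) (at x)"
    using d[of 0 x] by (simp add: DERIV_deriv_iff_real_differentiable)
  show "continuous_on UNIV \<rho>" "continuous_on UNIV (deriv \<rho>)"
    using d[of 0] d[of 1]
    by (auto intro!: differentiable_imp_continuous_on simp: differentiable_on_def)
qed (use assms in \<open>auto simp: mollifier_def\<close>)

text \<open>The kernel lives on the window from \<open>t\<close> to \<open>t + \<delta>\<close>, so
  any interval covering the nonnegative part of the window gives the same integral. The choice
  \<open>a = 0\<close> with a fixed \<open>R\<close> serves differentiation and also admits negative
  \<open>t\<close>; \<open>a = t\<close>, \<open>R = t + \<delta>\<close> serves
  convergence.\<close>

lemma mollified_eq_integral:
  fixes W :: "real \<Rightarrow> 'a \<Rightarrow> real"
  assumes rho: "mollifier \<rho>" and W: "continuous_on {0..} (\<lambda>t. W t \<omega>)"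
    and "0 < \<delta>" and a: "0 \<le> a" "a = 0 \<or> a \<le> t" and R: "t + \<delta> \<le> R"
  shows "mollified \<rho> \<delta> W t \<omega> = 1 / \<delta> * integral {a..R} (\<lambda>s. W s \<omega> * \<rho> ((s - t) / \<delta>))"
proof -
  let ?g = "\<lambda>s. W s \<omega> * \<rho> ((s - t) / \<delta>)"
  have "?g s = 0" if "s \<notin> {a..R}" "0 \<le> s" for s
  proof -
    have "(s - t) / \<delta> \<notin> {0..1}" using that R a \<open>0 < \<delta>\<close> by (auto simp: field_simps)
    then show ?thesis using mollifierD(4)[OF rho] by simp
  qed
  then have eq: "indicator {0..} s *\<^sub>R ?g s = indicator {a..R} s *\<^sub>R ?g s" for s
    using \<open>0 \<le> a\<close> by (cases "s \<in> {a..R}"; cases "0 \<le> s") simp_all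
  have "(LBINT s:{0..}. ?g s) = (LBINT s:{a..R}. ?g s)"
    unfolding set_lebesgue_integral_def eq by (rule refl)
  also have "continuous_on {a..R} ?g"
    using \<open>0 \<le> a\<close> \<open>0 < \<delta>\<close>
    by (intro continuous_intros continuous_on_subset[OF W]
        continuous_on_compose2[OF mollifierD(2)[OF rho]]) auto
  then have "(LBINT s:{a..R}. ?g s) = integral {a..R} ?g"
    by (intro set_borel_integral_eq_integral borel_integrable_atLeastAtMost')
  finally show ?thesis by (simp add: mollified_def)
qed

text \<open>The derivative falls on the smooth kernel, so continuity of the path suffices. As long
  as \<open>t + \<delta> < R\<close>, the domain of integration can be frozen to
  \<open>{0..R}\<close>, which is what Leibniz' rule needs; both claims are local in
  \<open>t\<close>, so a suitable \<open>R\<close> always exists.\<close>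

lemma DERIV_mollified:
  fixes W :: "real \<Rightarrow> 'a \<Rightarrow> real"
  assumes rho: "mollifier \<rho>" and W: "continuous_on {0..} (\<lambda>t. W t \<omega>)" and "0 < \<delta>"
  shows "((\<lambda>t. mollified \<rho> \<delta> W t \<omega>) has_real_derivative deriv (\<lambda>t. mollified \<rho> \<delta> W t \<omega>) t) (at t)"
    and "continuous_on {0..T} (deriv (\<lambda>t. mollified \<rho> \<delta> W t \<omega>))"
proof -
  let ?m = "\<lambda>t. mollified \<rho> \<delta> W t \<omega>"
  let ?d = "\<lambda>R t. 1 / \<delta> * integral (cbox 0 R) (\<lambda>s. W s \<omega> * (deriv \<rho> ((s - t) / \<delta>) * (- 1 / \<delta>)))"
  have cc: "continuous_on ({..<R - \<delta>} \<times> cbox 0 R)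
      (\<lambda>(t, s). W s \<omega> * (deriv \<rho> ((s - t) / \<delta>) * (- 1 / \<delta>)))" for R
    unfolding split_beta using \<open>0 < \<delta>\<close>
    by (intro continuous_intros continuous_on_compose2[OF W]
        continuous_on_compose2[OF mollifierD(3)[OF rho]]) auto
  have D: "(?m has_real_derivative ?d R t) (at t)" if t: "t < R - \<delta>" for t R
  proof -
    have "((\<lambda>t. integral (cbox 0 R) (\<lambda>s. W s \<omega> * \<rho> ((s - t) / \<delta>))) has_real_derivative
       integral (cbox 0 R) (\<lambda>s. W s \<omega> * (deriv \<rho> ((s - t) / \<delta>) * (- 1 / \<delta>)))) (at t within {..<R - \<delta>})"
    proof (rule leibniz_rule_field_derivative[OF _ _ cc])
      show "((\<lambda>t. W s \<omega> * \<rho> ((s - t) / \<delta>)) has_real_derivative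
          W s \<omega> * (deriv \<rho> ((s - t) / \<delta>) * (- 1 / \<delta>))) (at t within {..<R - \<delta>})" for t s
        by (intro DERIV_cmult DERIV_chain2[OF mollifierD(1)[OF rho]])
          (use \<open>0 < \<delta>\<close> in \<open>auto intro!: derivative_eq_intros\<close>)
      show "(\<lambda>s. W s \<omega> * \<rho> ((s - t) / \<delta>)) integrable_on cbox 0 R" for t
        using \<open>0 < \<delta>\<close>
        by (intro integrable_continuous continuous_intros continuous_on_subset[OF W]
            continuous_on_compose2[OF mollifierD(2)[OF rho]]) auto
    qed (use t in auto)
    then have "((\<lambda>t. 1 / \<delta> * integral (cbox 0 R) (\<lambda>s. W s \<omega> * \<rho> ((s - t) / \<delta>))) has_real_derivative ?d R t) (at t)"
      using t by (intro DERIV_cmult) (simp add: at_within_open[of t "{..<R - \<delta>}"])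
    then show ?thesis
      by (rule has_field_derivative_transform_within_open[where S="{..<R - \<delta>}"])
        (use t \<open>0 < \<delta>\<close> in \<open>auto simp: mollified_eq_integral[where W=W and \<omega>=\<omega>, OF rho W, of _ 0 _ R]\<close>)
  qed
  have dd: "deriv ?m t = ?d R t" if "t < R - \<delta>" for t R by (rule DERIV_imp_deriv[OF D[OF that]])
  show "(?m has_real_derivative deriv ?m t) (at t)"
    using D[of t "t + \<delta> + 1"] dd[of t "t + \<delta> + 1"] by simp
  have "continuous_on {..<(T + \<delta> + 1) - \<delta>} (?d (T + \<delta> + 1))"
    using integral_continuous_on_param[OF cc] by (intro continuous_intros)
  then have "continuous_on {0..T} (?d (T + \<delta> + 1))" by (rule continuous_on_subset) auto
  then show "continuous_on {0..T} (deriv ?m)"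
    by (subst continuous_on_cong[OF refl dd[of _ "T + \<delta> + 1"]]) auto
qed

text \<open>The mollified value is an average of the path over the window with total weight 1, and
  the path oscillates little there. The kernel may change sign, so its supremum bound
  \<open>B\<close> enters the tolerance \<open>e / (2 * B)\<close>. Uniform continuity is taken on
  \<open>{0..T+1}\<close> because windows starting in \<open>{0..T}\<close> overshoot by \<delta> <
  1.\<close>

lemma mollified_tendsto:
  fixes W :: "real \<Rightarrow> 'a \<Rightarrow> real"
  assumes rho: "mollifier \<rho>" and W: "continuous_on {0..} (\<lambda>t. W t \<omega>)"
  shows "uniform_limit {0..T} (\<lambda>\<delta> t. mollified \<rho> \<delta> W t \<omega>) (\<lambda>t. W t \<omega>) (at_right 0)"
proof (rule uniform_limitI)
  fix e :: real assume "0 < e"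
  have "bounded (\<rho> ` {0..1})"
    by (intro compact_imp_bounded compact_continuous_image continuous_on_subset[OF mollifierD(2)[OF rho]]) auto
  then obtain B where B: "0 < B" "\<And>x. x \<in> {0..1} \<Longrightarrow> \<bar>\<rho> x\<bar> \<le> B"
    unfolding bounded_pos by force
  have "uniformly_continuous_on {0..T+1} (\<lambda>t. W t \<omega>)"
    by (intro compact_uniformly_continuous continuous_on_subset[OF W]) auto
  then obtain d where d: "0 < d" "\<And>s t. s \<in> {0..T+1} \<Longrightarrow> t \<in> {0..T+1} \<Longrightarrow> \<bar>s - t\<bar> < d \<Longrightarrow> \<bar>W s \<omega> - W t \<omega>\<bar> < e / (2 * B)"
    unfolding uniformly_continuous_on_def dist_real_def using \<open>0 < e\<close> \<open>0 < B\<close>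
    by (metis divide_pos_pos mult_pos_pos zero_less_numeral)
  have "\<forall>\<^sub>F \<delta> in at_right 0. \<delta> \<in> {0<..<min 1 d}"
    using d by (intro eventually_at_right_real) auto
  then show "\<forall>\<^sub>F \<delta> in at_right 0. \<forall>t\<in>{0..T}. dist (mollified \<rho> \<delta> W t \<omega>) (W t \<omega>) < e"
  proof (eventually_elim, safe)
    fix \<delta> t :: real assume \<delta>: "\<delta> \<in> {0<..<min 1 d}" and t: "t \<in> {0..T}"
    have cr: "continuous_on {t..t+\<delta>} (\<lambda>s. \<rho> ((s - t) / \<delta>))"
      using \<delta> by (intro continuous_intros continuous_on_compose2[OF mollifierD(2)[OF rho]]) auto
    have cW: "continuous_on {t..t+\<delta>} (\<lambda>s. W s \<omega>)"
      using t by (intro continuous_on_subset[OF W]) auto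
    \<comment> \<open>A primitive of the kernel stands in for a change of variables: it shows that
      the rescaled kernel has integral \<delta> over the window.\<close>
    define P where "P = primitive \<rho>"
    have P: "(P has_real_derivative \<rho> x) (at x)" for x
      unfolding P_def by (rule DERIV_primitive[OF mollifierD(2)[OF rho]])
    have "(\<rho> has_integral P 1 - P 0) {0..1}"
      by (intro fundamental_theorem_of_calculus)
       (auto simp: has_real_derivative_iff_has_vector_derivative[symmetric] intro: DERIV_subset[OF P])
    then have P1: "P 1 - P 0 = 1" using mollifierD(5)[OF rho] by (simp add: integral_unique)
    have "((\<lambda>s. \<rho> ((s - t) / \<delta>)) has_integral \<delta> * P ((t + \<delta> - t) / \<delta>) - \<delta> * P ((t - t) / \<delta>)) {t..t+\<delta>}"
    proof (intro fundamental_theorem_of_calculus)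
      have "((\<lambda>s. \<delta> * P ((s - t) / \<delta>)) has_real_derivative \<delta> * (\<rho> ((s - t) / \<delta>) * (1 / \<delta>))) (at s within {t..t+\<delta>})" for s
        using \<delta> by (intro DERIV_cmult DERIV_chain2[OF P]) (auto intro!: derivative_eq_intros)
      then show "((\<lambda>s. \<delta> * P ((s - t) / \<delta>)) has_vector_derivative \<rho> ((s - t) / \<delta>)) (at s within {t..t+\<delta>})" for s
        using \<delta> by (simp add: has_real_derivative_iff_has_vector_derivative)
    qed (use \<delta> in auto)
    then have I: "integral {t..t+\<delta>} (\<lambda>s. \<rho> ((s - t) / \<delta>)) = \<delta>"
      using \<delta> P1 by (simp add: integral_unique right_diff_distrib[symmetric])
    have "mollified \<rho> \<delta> W t \<omega> - W t \<omega>
        = 1 / \<delta> * integral {t..t+\<delta>} (\<lambda>s. W s \<omega> * \<rho> ((s - t) / \<delta>)) - 1 / \<delta> * (W t \<omega> * \<delta>)"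
      using \<delta> t by (subst mollified_eq_integral[where W=W and \<omega>=\<omega>, OF rho W, of _ t _ "t + \<delta>"]) auto
    also have "\<dots> = 1 / \<delta> * (integral {t..t+\<delta>} (\<lambda>s. W s \<omega> * \<rho> ((s - t) / \<delta>))
        - integral {t..t+\<delta>} (\<lambda>s. W t \<omega> * \<rho> ((s - t) / \<delta>)))"
      using I by (simp add: right_diff_distrib)
    also have "\<dots> = 1 / \<delta> * integral {t..t+\<delta>} (\<lambda>s. (W s \<omega> - W t \<omega>) * \<rho> ((s - t) / \<delta>))"
      unfolding left_diff_distrib
      by (subst integral_diff) (auto intro!: integrable_continuous_real continuous_intros cr cW)
    finally have eq: "mollified \<rho> \<delta> W t \<omega> - W t \<omega> = \<dots>" .
    have "norm (integral {t..t+\<delta>} (\<lambda>s. (W s \<omega> - W t \<omega>) * \<rho> ((s - t) / \<delta>))) \<le> (e / (2 * B) * B) * (t + \<delta> - t)"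
    proof (rule integral_bound)
      fix s assume s: "s \<in> {t..t+\<delta>}"
      have "\<bar>W s \<omega> - W t \<omega>\<bar> < e / (2 * B)" using s t \<delta> by (intro d(2)) auto
      moreover have "\<bar>\<rho> ((s - t) / \<delta>)\<bar> \<le> B" using s \<delta> by (intro B) (auto simp: field_simps)
      ultimately show "norm ((W s \<omega> - W t \<omega>) * \<rho> ((s - t) / \<delta>)) \<le> e / (2 * B) * B"
        unfolding real_norm_def abs_mult by (intro mult_mono) auto
    qed (use \<delta> in \<open>auto intro!: continuous_intros cr cW\<close>)
    then have "norm (integral {t..t+\<delta>} (\<lambda>s. (W s \<omega> - W t \<omega>) * \<rho> ((s - t) / \<delta>))) \<le> e / 2 * \<delta>"
      using B by simp
    then have "1 / \<delta> * norm (integral {t..t+\<delta>} (\<lambda>s. (W s \<omega> - W t \<omega>) * \<rho> ((s - t) / \<delta>))) \<le> e / 2"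
      using \<delta> by (simp add: field_simps)
    then have "\<bar>mollified \<rho> \<delta> W t \<omega> - W t \<omega>\<bar> \<le> e / 2"
      unfolding eq using \<delta> by (simp add: abs_mult)
    then show "dist (mollified \<rho> \<delta> W t \<omega>) (W t \<omega>) < e" using \<open>0 < e\<close> by (simp add: dist_real_def)
  qed
qed

text \<open>The limit of the ratio gives a global bound on \<open>\<bar>L y - m * y\<bar>\<close> by
  a small multiple of \<open>\<bar>y\<bar>\<close> plus a constant, the Lipschitz estimate absorbing
  the bounded range of \<open>y\<close>. Putting \<open>y = x / \<epsilon>\<close> and multiplying
  by \<epsilon> keeps the first term small for bounded \<open>x\<close> and shrinks the constant to
  0.\<close>

lemma rescaled_primitive_tendsto:
  fixes L :: "real \<Rightarrow> real"
  assumes L: "\<And>x y. \<bar>L x - L y\<bar> \<le> K * \<bar>x - y\<bar>" and "L 0 = 0"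
    and lim: "((\<lambda>x. L x / x) \<longlongrightarrow> m) at_infinity"
  shows "uniform_limit {-R..R} (\<lambda>\<epsilon> x. \<epsilon> * L (x / \<epsilon>)) (\<lambda>x. m * x) (at_right 0)"
proof (rule uniform_limitI)
  fix e :: real assume "0 < e"
  define \<eta> where "\<eta> = e / (2 * (\<bar>R\<bar> + 1))"
  have "0 < \<eta>" using \<open>0 < e\<close> by (simp add: \<eta>_def)
  from tendstoD[OF lim this] obtain N where N: "\<And>x. N \<le> \<bar>x\<bar> \<Longrightarrow> \<bar>L x / x - m\<bar> < \<eta>"
    by (auto simp: eventually_at_infinity dist_real_def)
  define N' where "N' = \<bar>N\<bar> + 1"
  have K: "\<bar>L x\<bar> \<le> \<bar>K\<bar> * \<bar>x\<bar>" for x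
    using L[of x 0] \<open>L 0 = 0\<close> by (simp add: order.trans[OF _ mult_right_mono[OF abs_ge_self]])
  have main: "\<bar>L x - m * x\<bar> \<le> \<eta> * \<bar>x\<bar> + (\<bar>K\<bar> + \<bar>m\<bar>) * N'" for x
  proof (cases "N' \<le> \<bar>x\<bar>")
    case True
    then have "x \<noteq> 0" "N \<le> \<bar>x\<bar>" by (auto simp: N'_def)
    then have "\<bar>L x - m * x\<bar> = \<bar>L x / x - m\<bar> * \<bar>x\<bar>" by (simp add: abs_mult[symmetric] left_diff_distrib)
    also have "\<dots> \<le> \<eta> * \<bar>x\<bar>" using N[OF \<open>N \<le> \<bar>x\<bar>\<close>] by (intro mult_right_mono) auto
    moreover have "0 \<le> (\<bar>K\<bar> + \<bar>m\<bar>) * N'" by (simp add: N'_def)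
    ultimately show ?thesis by linarith
  next
    case False
    have "\<bar>L x - m * x\<bar> \<le> \<bar>K\<bar> * \<bar>x\<bar> + \<bar>m\<bar> * \<bar>x\<bar>"
      using K[of x] abs_triangle_ineq4[of "L x" "m * x"] by (simp add: abs_mult)
    also have "\<dots> = (\<bar>K\<bar> + \<bar>m\<bar>) * \<bar>x\<bar>" by (simp add: algebra_simps)
    also have "\<dots> \<le> (\<bar>K\<bar> + \<bar>m\<bar>) * N'" using False by (intro mult_left_mono) auto
    moreover have "0 \<le> \<eta> * \<bar>x\<bar>" using \<open>0 < \<eta>\<close> by simp
    ultimately show ?thesis by linarith
  qed
  \<comment> \<open>The added 1 keeps \<open>D\<close> positive even if \<open>K\<close> and
    \<open>m\<close> vanish, so that it may be divided by.\<close>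
  define D where "D = (\<bar>K\<bar> + \<bar>m\<bar>) * N' + 1"
  have "0 < D" by (auto simp: D_def N'_def intro!: add_nonneg_pos mult_nonneg_nonneg)
  have "\<forall>\<^sub>F \<epsilon> in at_right 0. \<epsilon> \<in> {0<..<e / (2 * D)}"
    using \<open>0 < e\<close> \<open>0 < D\<close> by (intro eventually_at_right_real) auto
  then show "\<forall>\<^sub>F \<epsilon> in at_right 0. \<forall>x\<in>{-R..R}. dist (\<epsilon> * L (x / \<epsilon>)) (m * x) < e"
  proof (eventually_elim, safe)
    fix \<epsilon> x :: real assume \<epsilon>: "\<epsilon> \<in> {0<..<e / (2 * D)}" and x: "x \<in> {-R..R}"
    have "\<bar>\<epsilon> * L (x / \<epsilon>) - m * x\<bar> = \<epsilon> * \<bar>L (x / \<epsilon>) - m * (x / \<epsilon>)\<bar>"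
      using \<epsilon> abs_mult[of \<epsilon> "L (x / \<epsilon>) - m * (x / \<epsilon>)"] by (simp add: right_diff_distrib)
    also have "\<dots> \<le> \<epsilon> * (\<eta> * \<bar>x / \<epsilon>\<bar> + (\<bar>K\<bar> + \<bar>m\<bar>) * N')"
      using \<epsilon> by (intro mult_left_mono main) auto
    also have "\<dots> \<le> \<eta> * \<bar>x\<bar> + \<epsilon> * D" using \<epsilon> by (simp add: algebra_simps abs_mult D_def)
    also have "\<eta> * \<bar>x\<bar> \<le> \<eta> * (\<bar>R\<bar> + 1)" using x \<open>0 < \<eta>\<close> by (intro mult_left_mono) auto
    also have "\<dots> = e / 2" unfolding \<eta>_def by (simp add: divide_simps add_nonneg_eq_0_iff)
    also have "\<epsilon> * D < e / (2 * D) * D" using \<epsilon> \<open>0 < D\<close> by (intro mult_strict_right_mono) auto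
    also have "\<dots> = e / 2" using \<open>0 < D\<close> by simp
    finally show "dist (\<epsilon> * L (x / \<epsilon>)) (m * x) < e" by (simp add: dist_real_def)
  qed
qed

section \<open>Weak convergence on path space\<close>

lemma mspace_path:
  "f \<in> mspace (cfunspace (top_of_set {0..T}) euclidean_metric) \<longleftrightarrow>
     f \<in> extensional {0..T} \<and> continuous_on {0..T} (f :: real \<Rightarrow> real)"
proof -
  have "bounded (f ` {0..T})" if "continuous_on {0..T} f"
    by (intro compact_imp_bounded compact_continuous_image that) simp
  then show ?thesis by auto
qed

lemma topspace_path_topology:
  "topspace (path_topology T) = {f \<in> extensional {0..T}. continuous_on {0..T} f}"
  using mspace_path by (auto simp: path_topology_def)

lemma restrict_in_path_space:
  "continuous_on {0..T} x \<Longrightarrow> (\<lambda>t\<in>{0..T}. x t) \<in> topspace (path_topology T)"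
  by (auto simp: topspace_path_topology cong: continuous_on_cong_simp)

lemma mdist_path_le:
  assumes "0 \<le> T" "f \<in> topspace (path_topology T)" "g \<in> topspace (path_topology T)"
  shows "mdist (cfunspace (top_of_set {0..T}) euclidean_metric) f g \<le> a \<longleftrightarrow>
    (\<forall>t\<in>{0..T}. \<bar>f t - g t\<bar> \<le> a)"
  using cfunspace_mdist_le[of f "top_of_set {0..T}" euclidean_metric g a] assms
  unfolding path_topology_def topspace_mtopology_of by (simp add: dist_real_def)

text \<open>A countable dense family in \<open>C[0,T]\<close>: it makes every open set a countable union of closed balls,
  each of which is determined by countably many coordinates.\<close>

definition rational_bernstein :: "real \<Rightarrow> rat list \<Rightarrow> real \<Rightarrow> real" where
  "rational_bernstein T cs t =
     (\<Sum>k\<le>length cs - 1. of_rat (cs ! k) * Bernstein (length cs - 1) k (t / T))"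

lemma continuous_rational_bernstein: "T \<noteq> 0 \<Longrightarrow> continuous_on A (rational_bernstein T cs)"
  unfolding rational_bernstein_def Bernstein_def by (intro continuous_intros) auto

text \<open>Half of \<open>e\<close> pays for the Bernstein approximation, the other half for
  rounding the coefficients. Rounding errors are not amplified, because the Bernstein weights are
  nonnegative and sum to 1.\<close>

lemma rational_bernstein_dense:
  assumes f: "continuous_on {0..T} f" and "0 < T" "0 < (e :: real)"
  obtains cs where "\<And>t. t \<in> {0..T} \<Longrightarrow> \<bar>f t - rational_bernstein T cs t\<bar> \<le> e"
proof -
  have "continuous_on {0..1} (\<lambda>u. f (T * u))"
    by (rule continuous_on_compose2[OF f])
      (use \<open>0 < T\<close> in \<open>auto intro!: continuous_intros mult_left_le\<close>)
  from Bernstein_Weierstrass[OF this, of "e / 2"] \<open>0 < e\<close> obtain n where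
    "\<forall>m u. n \<le> m \<and> u \<in> {0..1} \<longrightarrow>
      \<bar>f (T * u) - (\<Sum>k\<le>m. f (T * (real k / real m)) * Bernstein m k u)\<bar> < e / 2"
    by auto
  then have n: "\<bar>f (T * u) - (\<Sum>k\<le>n. f (T * (k / n)) * Bernstein n k u)\<bar> < e / 2"
    if "u \<in> {0..1}" for u using that by blast
  have "\<exists>r::rat. \<bar>f (T * (k / n)) - of_rat r\<bar> < e / 2" for k :: nat
  proof -
    obtain r where "f (T * (k / n)) - e / 2 < of_rat r" "of_rat r < f (T * (k / n))"
      using of_rat_dense[of "f (T * (k / n)) - e / 2" "f (T * (k / n))"] \<open>0 < e\<close> by auto
    then show ?thesis by (intro exI[of _ r]) linarith
  qed
  then obtain r where r: "\<And>k :: nat. \<bar>f (T * (k / n)) - real_of_rat (r k)\<bar> < e / 2" by metis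
  define cs where "cs = map r [0..<Suc n]"
  show thesis
  proof (rule that)
    fix t assume t: "t \<in> {0..T}"
    define u where "u = t / T"
    have u: "u \<in> {0..1}" "T * u = t" using t \<open>0 < T\<close> by (auto simp: u_def)
    have "rational_bernstein T cs t = (\<Sum>k\<le>n. of_rat (r k) * Bernstein n k u)"
      unfolding rational_bernstein_def cs_def u_def
      by (intro sum.cong) (auto simp del: upt_Suc)
    then have "\<bar>(\<Sum>k\<le>n. f (T * (k / n)) * Bernstein n k u) - rational_bernstein T cs t\<bar>
      = \<bar>\<Sum>k\<le>n. (f (T * (k / n)) - of_rat (r k)) * Bernstein n k u\<bar>"
      by (simp add: sum_subtractf left_diff_distrib)
    also have "\<dots> \<le> (\<Sum>k\<le>n. \<bar>(f (T * (k / n)) - of_rat (r k)) * Bernstein n k u\<bar>)"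
      by (rule sum_abs)
    also have "\<dots> \<le> (\<Sum>k\<le>n. e / 2 * Bernstein n k u)"
      unfolding abs_mult using u Bernstein_nonneg[of u n]
      by (intro sum_mono mult_mono less_imp_le[OF r]) (use \<open>0 < e\<close> in auto)
    also have "\<dots> = e / 2" unfolding sum_distrib_left[symmetric] by simp
    finally show "\<bar>f t - rational_bernstein T cs t\<bar> \<le> e"
      using n[OF u(1), unfolded u(2)] by linarith
  qed
qed

lemma path_measurable:
  assumes X: "continuous_process M X" and "0 < T"
  shows "(\<lambda>\<omega>. \<lambda>t\<in>{0..T}. X t \<omega>) \<in> measurable M (topology_borel (path_topology T))"
  unfolding topology_borel_def
proof (rule measurable_measure_of)
  let ?m = "cfunspace (top_of_set {0..T}) (euclidean_metric :: real metric)"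
  let ?P = "\<lambda>\<omega>. \<lambda>t\<in>{0..T}. X t \<omega>"
  let ?h = "\<lambda>cs. restrict (rational_bernstein T cs) {0..T}"
  interpret Metric_space "mspace ?m" "mdist ?m" by (rule Metric_space_mspace_mdist)
  have tops: "topspace (path_topology T) = mspace ?m" by (simp only: path_topology_def topspace_mtopology_of)
  have cX: "continuous_on {0..T} (\<lambda>t. X t \<omega>)" if "\<omega> \<in> space M" for \<omega>
    using X that by (auto simp: continuous_process_def intro: continuous_on_subset)
  have P: "?P \<omega> \<in> mspace ?m" if "\<omega> \<in> space M" for \<omega>
    using restrict_in_path_space[OF cX[OF that]] unfolding tops .
  have h: "?h cs \<in> mspace ?m" for cs
    using restrict_in_path_space[OF continuous_rational_bernstein[of T "{0..T}" cs]] \<open>0 < T\<close>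
    unfolding tops by simp
  show "{U. openin (path_topology T) U} \<subseteq> Pow (topspace (path_topology T))"
    by (auto dest: openin_subset)
  show "?P \<in> space M \<rightarrow> topspace (path_topology T)" using P tops by auto
  fix U assume "U \<in> {U. openin (path_topology T) U}"
  then have U: "openin mtopology U" by (simp add: path_topology_def mtopology_of_def)
  \<comment> \<open>A closed ball condition tested at countably many times. The times are rational
    points of the open interval because density of the rationals in an open set has its closure,
    here \<open>{0..T}\<close>, at hand; continuity carries the non-strict inequality over to
    it.\<close>
  define B where "B cs n = {\<omega> \<in> space M. \<forall>t\<in>{0<..<T} \<inter> \<rat>. \<bar>X t \<omega> - rational_bernstein T cs t\<bar> \<le> 1 / Suc n}"
    for cs and n :: nat
  have B_eq: "B cs n = {\<omega> \<in> space M. ?P \<omega> \<in> mcball (?h cs) (1 / Suc n)}" for cs n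
  proof -
    have "closure ({0<..<T} \<inter> \<rat>) = {0..T}"
      using closure_open_Int_superset[of "{0<..<T}" \<rat>] \<open>0 < T\<close> by (simp add: Rats_closure_real)
    moreover have "continuous_on {0..T} (\<lambda>t. \<bar>X t \<omega> - rational_bernstein T cs t\<bar>)"
      if "\<omega> \<in> space M" for \<omega>
      using cX[OF that] continuous_rational_bernstein[of T "{0..T}" cs] \<open>0 < T\<close>
      by (auto intro!: continuous_intros)
    ultimately have "\<bar>X t \<omega> - rational_bernstein T cs t\<bar> \<le> 1 / Suc n"
      if "\<omega> \<in> space M" "\<forall>t\<in>{0<..<T} \<inter> \<rat>. \<bar>X t \<omega> - rational_bernstein T cs t\<bar> \<le> 1 / Suc n" "t \<in> {0..T}"
      for \<omega> t
      using continuous_le_on_closure[of "{0<..<T} \<inter> \<rat>" "\<lambda>t. \<bar>X t \<omega> - rational_bernstein T cs t\<bar>" t "1 / Suc n"]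
        that by simp
    then have "(\<forall>t\<in>{0<..<T} \<inter> \<rat>. \<bar>X t \<omega> - rational_bernstein T cs t\<bar> \<le> 1 / Suc n) \<longleftrightarrow>
        (\<forall>t\<in>{0..T}. \<bar>X t \<omega> - rational_bernstein T cs t\<bar> \<le> 1 / Suc n)" if "\<omega> \<in> space M" for \<omega>
      using that by (intro iffI ballI) auto
    moreover have "?P \<omega> \<in> mcball (?h cs) (1 / Suc n) \<longleftrightarrow>
        (\<forall>t\<in>{0..T}. \<bar>X t \<omega> - rational_bernstein T cs t\<bar> \<le> 1 / Suc n)" if "\<omega> \<in> space M" for \<omega>
      using mdist_path_le[of T "?h cs" "?P \<omega>" "1 / Suc n"] P[OF that] h[of cs] \<open>0 < T\<close>
      unfolding tops in_mcball by (simp add: abs_minus_commute)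
    ultimately show ?thesis unfolding B_def by blast
  qed
  have "B cs n \<in> sets M" for cs n
  proof -
    have "{\<omega> \<in> space M. \<bar>X t \<omega> - rational_bernstein T cs t\<bar> \<le> 1 / Suc n} \<in> sets M"
      if "t \<in> {0<..<T} \<inter> \<rat>" for t
    proof -
      have [measurable]: "X t \<in> borel_measurable M" using X that by (auto simp: continuous_process_def)
      show ?thesis by measurable
    qed
    then show ?thesis
      unfolding B_def by (intro sets.sets_Collect_countable_All' countable_Int2 countable_rat)
  qed
  have "?P -` U \<inter> space M = (\<Union>(cs, n)\<in>{(cs, n). mcball (?h cs) (1 / Suc n) \<subseteq> U}. B cs n)"
  proof (intro equalityI subsetI)
    fix \<omega> assume \<omega>: "\<omega> \<in> ?P -` U \<inter> space M"
    then obtain r where r: "0 < r" "mcball (?P \<omega>) r \<subseteq> U" using U unfolding openin_mtopology_mcball by blast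
    \<comment> \<open>Half the radius: the centre lies within \<open>1 / Suc n\<close> of the path,
      and the ball adds another \<open>1 / Suc n\<close>.\<close>
    obtain n where n: "1 / real (Suc n) < r / 2"
      using nat_approx_posE[of "r / 2"] r(1) by (metis half_gt_zero)
    obtain cs where cs: "\<And>t. t \<in> {0..T} \<Longrightarrow> \<bar>X t \<omega> - rational_bernstein T cs t\<bar> \<le> 1 / Suc n"
      using rational_bernstein_dense[OF cX \<open>0 < T\<close>, of \<omega> "1 / Suc n"] \<omega> by auto
    have \<omega>M: "\<omega> \<in> space M" using \<omega> by blast
    have d: "mdist ?m (?h cs) (?P \<omega>) \<le> 1 / Suc n"
      using mdist_path_le[of T "?P \<omega>" "?h cs" "1 / Suc n"] P[OF \<omega>M] h[of cs] \<open>0 < T\<close> cs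
      unfolding tops commute[of "?h cs"] by auto
    then have mem: "?P \<omega> \<in> mcball (?h cs) (1 / Suc n)"
      unfolding in_mcball using P[OF \<omega>M] h[of cs] by blast
    have "mdist ?m (?h cs) (?P \<omega>) + 1 / Suc n \<le> r" using d n by linarith
    then have "mcball (?h cs) (1 / Suc n) \<subseteq> mcball (?P \<omega>) r"
      by (rule mcball_subset[OF _ P[OF \<omega>M]])
    with r(2) mem \<omega> show "\<omega> \<in> (\<Union>(cs, n)\<in>{(cs, n). mcball (?h cs) (1 / Suc n) \<subseteq> U}. B cs n)"
      unfolding B_eq by blast
  qed (auto simp: B_eq)
  also have "\<dots> \<in> sets M"
    by (rule sets.countable_UN') (auto simp: \<open>\<And>cs n. B cs n \<in> sets M\<close>)
  finally show "?P -` U \<inter> space M \<in> sets M" .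
qed


lemma borel_probability_path_law:
  assumes "prob_space M" "continuous_process M X" "0 < T"
  shows "borel_probability (path_topology T) (path_law M T X)"
  unfolding borel_probability_def path_law_def
  using prob_space.prob_space_distr[OF assms(1) path_measurable[OF assms(2,3)]] by simp

section \<open>From pathwise to weak convergence\<close>

lemma continuous_map_topology_borel_measurable:
  assumes "continuous_map X euclideanreal f"
  shows "f \<in> borel_measurable (topology_borel X)"
proof (rule borel_measurableI)
  fix S :: "real set" assume "open S"
  have s: "{U. openin X U} \<subseteq> Pow (topspace X)" by (auto dest: openin_subset)
  have "openin X {x \<in> topspace X. f x \<in> S}"
    using assms \<open>open S\<close> by (auto simp: continuous_map_def)
  moreover have "f -` S \<inter> space (topology_borel X) = {x \<in> topspace X. f x \<in> S}"
    using s by (auto simp: topology_borel_def space_measure_of)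
  ultimately show "f -` S \<inter> space (topology_borel X) \<in> sets (topology_borel X)"
    using s by (auto simp: topology_borel_def sets_measure_of)
qed

lemma limitin_path_topology:
  assumes "0 \<le> T" and x: "continuous_on {0..T} x" and xs: "\<And>n. continuous_on {0..T} (xs n)"
    and lim: "uniform_limit {0..T} xs x F"
  shows "limitin (path_topology T) (\<lambda>n. \<lambda>t\<in>{0..T}. xs n t) (\<lambda>t\<in>{0..T}. x t) F"
proof -
  let ?m = "cfunspace (top_of_set {0..T}) (euclidean_metric :: real metric)"
  interpret Metric_space "mspace ?m" "mdist ?m" by (rule Metric_space_mspace_mdist)
  have tops: "topspace (path_topology T) = mspace ?m" by (simp only: path_topology_def topspace_mtopology_of)
  have m: "(\<lambda>t\<in>{0..T}. x t) \<in> mspace ?m" "(\<lambda>t\<in>{0..T}. xs n t) \<in> mspace ?m" for n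
    using restrict_in_path_space[OF x] restrict_in_path_space[OF xs] unfolding tops .
  have "\<forall>\<^sub>F n in F. mdist ?m (\<lambda>t\<in>{0..T}. xs n t) (\<lambda>t\<in>{0..T}. x t) < e" if "0 < e" for e
    using uniform_limitD[OF lim half_gt_zero[OF \<open>0 < e\<close>]]
  proof eventually_elim
    case (elim n)
    then have "mdist ?m (\<lambda>t\<in>{0..T}. xs n t) (\<lambda>t\<in>{0..T}. x t) \<le> e / 2"
      using mdist_path_le[OF \<open>0 \<le> T\<close>, unfolded tops, OF m(2) m(1), of n "e / 2"]
      by (auto simp: dist_real_def intro: less_imp_le)
    then show ?case using \<open>0 < e\<close> by linarith
  qed
  then show ?thesis
    using m unfolding path_topology_def mtopology_of_def limitin_metric by auto
qed

text \<open>One-sided limits of the real-valued integrals can be tested along sequences, so the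
  exceptional null set may depend on the sequence; dominated convergence with the constant bound of
  \<open>f\<close> does the rest. The set \<open>S\<close> lets a family be given only for small
  parameters, as with \<epsilon> in (0,1].\<close>

lemma weakly_converges_pathwise:
  fixes X :: "real \<Rightarrow> real \<Rightarrow> 'a \<Rightarrow> real"
  assumes "prob_space M" "0 < T"
    and S: "at 0 within S = at_right 0"
    and X: "\<And>i. i \<in> S \<Longrightarrow> continuous_process M (X i)" and Y: "continuous_process M Y"
    and lim: "\<And>I. (\<And>n. I n \<in> S - {0}) \<Longrightarrow> I \<longlonglongrightarrow> 0 \<Longrightarrow>
      AE \<omega> in M. uniform_limit {0..T} (\<lambda>n t. X (I n) t \<omega>) (\<lambda>t. Y t \<omega>) sequentially"
  shows "weakly_converges (path_topology T) (\<lambda>i. path_law M T (X i)) (path_law M T Y) (at_right 0)"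
  unfolding weakly_converges_def
proof (intro conjI allI impI)
  interpret prob_space M by fact
  have "\<forall>\<^sub>F i in at_right 0. i \<in> S" unfolding S[symmetric] by (simp add: eventually_at_filter)
  then show "\<forall>\<^sub>F i in at_right 0. borel_probability (path_topology T) (path_law M T (X i))"
    by eventually_elim (rule borel_probability_path_law[OF assms(1) X assms(2)])
  show "borel_probability (path_topology T) (path_law M T Y)"
    by (rule borel_probability_path_law[OF assms(1) Y assms(2)])
  fix f assume f: "continuous_map (path_topology T) euclideanreal f \<and> bounded (f ` topspace (path_topology T))"
  then have fm[measurable]: "f \<in> borel_measurable (topology_borel (path_topology T))"
    by (intro continuous_map_topology_borel_measurable) simp
  obtain C where C: "\<And>x. x \<in> topspace (path_topology T) \<Longrightarrow> \<bar>f x\<bar> \<le> C"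
    using f unfolding bounded_iff by auto
  define P where "P Z \<omega> = (\<lambda>t\<in>{0..T}. Z t \<omega>)" for Z :: "real \<Rightarrow> 'a \<Rightarrow> real" and \<omega>
  have Pm: "P Z \<in> measurable M (topology_borel (path_topology T))" if "continuous_process M Z" for Z
    using path_measurable[OF that \<open>0 < T\<close>] by (simp add: P_def[abs_def])
  have cZ: "continuous_on {0..T} (\<lambda>t. Z t \<omega>)" if "continuous_process M Z" "\<omega> \<in> space M" for Z \<omega>
    using that by (auto simp: continuous_process_def intro: continuous_on_subset)
  have int: "(\<integral>x. f x \<partial>path_law M T Z) = (\<integral>\<omega>. f (P Z \<omega>) \<partial>M)" if "continuous_process M Z" for Z
    unfolding path_law_def P_def using path_measurable[OF that \<open>0 < T\<close>] by (simp add: integral_distr)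
  show "((\<lambda>i. \<integral>x. f x \<partial>path_law M T (X i)) \<longlongrightarrow> (\<integral>x. f x \<partial>path_law M T Y)) (at_right 0)"
    unfolding S[symmetric] tendsto_at_iff_sequentially
  proof (intro allI impI)
    fix I :: "nat \<Rightarrow> real" assume I: "\<forall>n. I n \<in> S - {0}" "I \<longlonglongrightarrow> 0"
    have XI: "continuous_process M (X (I n))" for n using I X by auto
    have "(\<lambda>n. \<integral>\<omega>. f (P (X (I n)) \<omega>) \<partial>M) \<longlonglongrightarrow> (\<integral>\<omega>. f (P Y \<omega>) \<partial>M)"
    proof (rule integral_dominated_convergence[where w="\<lambda>_. C"])
      show "(\<lambda>\<omega>. f (P (X (I n)) \<omega>)) \<in> borel_measurable M" "(\<lambda>\<omega>. f (P Y \<omega>)) \<in> borel_measurable M" for n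
        using Pm[OF XI[of n]] Pm[OF Y] by measurable
      show "AE \<omega> in M. (\<lambda>n. f (P (X (I n)) \<omega>)) \<longlonglongrightarrow> f (P Y \<omega>)"
        using lim[OF I(1)[rule_format] I(2)] AE_space
      proof eventually_elim
        case (elim \<omega>)
        have "limitin (path_topology T) (\<lambda>n. P (X (I n)) \<omega>) (P Y \<omega>) sequentially"
          unfolding P_def using elim \<open>0 < T\<close> XI Y by (intro limitin_path_topology cZ) auto
        from continuous_map_limit[OF conjunct1[OF f] this] show ?case by (simp add: o_def)
      qed
      show "AE \<omega> in M. norm (f (P (X (I n)) \<omega>)) \<le> C" for n
        using AE_space
      proof eventually_elim
        case (elim \<omega>)
        show ?case using C[of "P (X (I n)) \<omega>"] restrict_in_path_space[OF cZ[OF XI elim]] by (simp add: P_def)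
      qed
    qed auto
    then show "((\<lambda>i. \<integral>x. f x \<partial>path_law M T (X i)) \<circ> I) \<longlonglongrightarrow> (\<integral>x. f x \<partial>path_law M T Y)"
      using XI Y by (simp add: int o_def)
  qed
qed

text \<open>\<open>continuous_process\<close> asks for continuity at every sample point, while
  limits provide it only almost surely. The bad set need not be measurable, so the path is reset to
  0 on a measurable null set containing it.\<close>

lemma continuous_process_modification:
  assumes Z: "\<And>t. 0 \<le> t \<Longrightarrow> Z t \<in> borel_measurable M"
    and AE: "AE \<omega> in M. continuous_on {0..} (\<lambda>t. Z t \<omega>)"
  obtains Y :: "real \<Rightarrow> 'a \<Rightarrow> real" where "continuous_process M Y" "AE \<omega> in M. \<forall>t. Y t \<omega> = Z t \<omega>"
proof -
  from AE obtain N where N: "{\<omega> \<in> space M. \<not> continuous_on {0..} (\<lambda>t. Z t \<omega>)} \<subseteq> N" "N \<in> null_sets M"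
    by (auto simp: eventually_ae_filter)
  define Y where "Y t \<omega> = (if \<omega> \<in> N then 0 else Z t \<omega>)" for t \<omega>
  have "N \<in> sets M" using N(2) by auto
  then have "continuous_process M Y"
    unfolding continuous_process_def
  proof (intro conjI allI impI ballI)
    fix t :: real assume "0 \<le> t"
    have [measurable]: "Z t \<in> borel_measurable M" "N \<in> sets M" using Z \<open>0 \<le> t\<close> \<open>N \<in> sets M\<close> by auto
    show "Y t \<in> borel_measurable M" unfolding Y_def[abs_def] by measurable
  next
    fix \<omega> assume "\<omega> \<in> space M"
    then show "continuous_on {0..} (\<lambda>t. Y t \<omega>)" using N(1) by (cases "\<omega> \<in> N") (auto simp: Y_def)
  qed
  moreover have "AE \<omega> in M. \<forall>t. Y t \<omega> = Z t \<omega>"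
    using AE_not_in[OF N(2)] by eventually_elim (simp add: Y_def)
  ultimately show thesis by (rule that)
qed

section \<open>The ergodic theorem for the friction\<close>

text \<open>The maximum of \<open>0\<close> and the first \<open>n\<close> Birkhoff sums; the recursion is what Garsia's proof of the
  maximal ergodic inequality uses.\<close>

fun birkhoff_max :: "('b \<Rightarrow> 'b) \<Rightarrow> ('b \<Rightarrow> real) \<Rightarrow> nat \<Rightarrow> 'b \<Rightarrow> real" where
  "birkhoff_max T g 0 x = 0"
| "birkhoff_max T g (Suc n) x = max 0 (g x + birkhoff_max T g n (T x))"

lemma birkhoff_max_nonneg: "0 \<le> birkhoff_max T g n x"
  by (cases n) auto

lemma birkhoff_max_Suc_mono: "birkhoff_max T g n x \<le> birkhoff_max T g (Suc n) x"
proof (induction n arbitrary: x)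
  case (Suc n)
  show ?case using Suc[of "T x"]
    unfolding birkhoff_max.simps(2)[of T g n x] birkhoff_max.simps(2)[of T g "Suc n" x]
    by (intro max.mono) auto
qed simp

lemma birkhoff_max_mono: "m \<le> n \<Longrightarrow> birkhoff_max T g m x \<le> birkhoff_max T g n x"
  by (rule lift_Suc_mono_le[of "\<lambda>n. birkhoff_max T g n x", OF birkhoff_max_Suc_mono])

lemma sum_le_birkhoff_max: "(\<Sum>i<n. g ((T ^^ i) x)) \<le> birkhoff_max T g n x"
proof (induction n arbitrary: x)
  case (Suc n)
  have "(\<Sum>i<Suc n. g ((T ^^ i) x)) = g x + (\<Sum>i<n. g ((T ^^ i) (T x)))"
    by (subst sum.lessThan_Suc_shift) (simp add: funpow_swap1)
  then show ?case using Suc[of "T x"] by simp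
qed simp

declare birkhoff_max.simps(2) [simp del]

text \<open>Where the maximum over \<open>Suc n\<close> steps is positive, the recursion bounds its
  decrease along \<open>T\<close> by \<open>g\<close>; elsewhere the decrease is at most 0. Its
  integral is 0 by invariance, so \<open>g\<close> has nonnegative integral over the positivity
  sets, and these exhaust the space almost everywhere by \<open>pos\<close>.\<close>

lemma maximal_ergodic:
  fixes g :: "'b \<Rightarrow> real"
  assumes T: "T \<in> measurable N N" and inv: "distr N N T = N" and g: "integrable N g"
    and pos: "AE x in N. \<exists>n. 0 < (\<Sum>i<n. g ((T ^^ i) x))"
  shows "0 \<le> (\<integral>x. g x \<partial>N)"
proof -
  let ?M = "birkhoff_max T g"
  have intT: "integrable N (\<lambda>x. h (T x))" "(\<integral>x. h (T x) \<partial>N) = (\<integral>x. h x \<partial>N)"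
    if "integrable N h" for h :: "_ \<Rightarrow> real"
    using that integrable_distr_eq[OF T, of h] integral_distr[OF T, of h]
      borel_measurable_integrable[OF that] unfolding inv by simp_all
  have iM: "integrable N (?M n)" for n
  proof (induction n)
    case (Suc n)
    show ?case unfolding birkhoff_max.simps(2)
      by (rule integrable_max[OF integrable_zero Bochner_Integration.integrable_add[OF g intT(1)[OF Suc]]])
  qed simp
  have [measurable]: "?M n \<in> borel_measurable N" "g \<in> borel_measurable N" for n
    using iM[THEN borel_measurable_integrable] g[THEN borel_measurable_integrable] by simp_all
  let ?A = "\<lambda>n. {x \<in> space N. 0 < ?M (Suc n) x}"
  have Am[measurable]: "?A n \<in> sets N" for n by measurable
  have ig: "integrable N (\<lambda>x. indicator (?A n) x * g x)" for n
    using integrable_mult_indicator[OF Am g] by simp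
  have "0 \<le> (\<integral>x. indicator (?A n) x * g x \<partial>N)" for n
  proof -
    have "0 = (\<integral>x. ?M (Suc n) x - ?M (Suc n) (T x) \<partial>N)"
      using iM[of "Suc n"] intT[OF iM[of "Suc n"]] by simp
    also have "\<dots> \<le> (\<integral>x. indicator (?A n) x * g x \<partial>N)"
    proof (rule integral_mono)
      fix x assume "x \<in> space N"
      show "?M (Suc n) x - ?M (Suc n) (T x) \<le> indicator (?A n) x * g x"
      proof (cases "0 < ?M (Suc n) x")
        case True
        then have "?M (Suc n) x = g x + ?M n (T x)" by (auto simp: birkhoff_max.simps(2) max_def split: if_splits)
        with True birkhoff_max_Suc_mono[of T g n "T x"] \<open>x \<in> space N\<close> show ?thesis
          by simp
      next
        case False
        then show ?thesis using birkhoff_max_nonneg[of T g "Suc n" "T x"]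
          by simp
      qed
    qed (use iM[of "Suc n"] intT[OF iM[of "Suc n"]] ig[of n] in simp_all)
    finally show ?thesis .
  qed
  moreover have "(\<lambda>n. \<integral>x. indicator (?A n) x * g x \<partial>N) \<longlonglongrightarrow> (\<integral>x. g x \<partial>N)"
  proof (rule integral_dominated_convergence[where w="\<lambda>x. \<bar>g x\<bar>"])
    show "AE x in N. (\<lambda>n. indicator (?A n) x * g x) \<longlonglongrightarrow> g x"
      using pos AE_space
    proof eventually_elim
      case (elim x)
      then obtain n where n: "0 < (\<Sum>i<n. g ((T ^^ i) x))" by blast
      have "0 < ?M (Suc m) x" if "n \<le> m" for m
        using n sum_le_birkhoff_max[of g T x n] birkhoff_max_mono[of n "Suc m" T g x] that by linarith
      then have "indicator (?A m) x * g x = g x" if "n \<le> m" for m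
        using elim(2) that by simp
      then have "\<forall>\<^sub>F m in sequentially. indicator (?A m) x * g x = g x"
        by (rule eventually_sequentiallyI[of n])
      then show ?case by (rule tendsto_eventually)
    qed
    show "AE x in N. norm (indicator (?A n) x * g x) \<le> \<bar>g x\<bar>" for n
      by (auto simp: indicator_def)
  qed (use g in auto)
  ultimately show ?thesis by (intro LIMSEQ_le_const) auto
qed

text \<open>If the limsup exceeded some \<open>c\<close> above the mean almost everywhere,
  \<open>f - c\<close> would have a positive Birkhoff sum almost everywhere and hence a nonnegative
  integral, a contradiction. The zero-one alternative is assumed only for the limsup events, in
  place of ergodicity of \<open>T\<close>, which ergodicity of a flow does not give for a single
  time step.\<close>

lemma limsup_birkhoff_average_le:
  fixes f :: "'b \<Rightarrow> real"
  assumes "prob_space N" and T: "T \<in> measurable N N" and inv: "distr N N T = N"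
    and f: "integrable N f"
    and zero_one: "\<And>c. (AE x in N. ereal c < limsup (\<lambda>n. ereal ((\<Sum>i<n. f ((T ^^ i) x)) / n))) \<or>
       (AE x in N. limsup (\<lambda>n. ereal ((\<Sum>i<n. f ((T ^^ i) x)) / n)) \<le> ereal c)"
  shows "AE x in N. limsup (\<lambda>n. ereal ((\<Sum>i<n. f ((T ^^ i) x)) / n)) \<le> ereal (\<integral>x. f x \<partial>N)"
proof -
  interpret prob_space N by fact
  let ?S = "\<lambda>n x. \<Sum>i<n. f ((T ^^ i) x)"
  have le: "AE x in N. limsup (\<lambda>n. ereal (?S n x / n)) \<le> ereal c" if c: "(\<integral>x. f x \<partial>N) < c" for c
  proof (rule ccontr)
    assume "\<not> ?thesis"
    then have "AE x in N. ereal c < limsup (\<lambda>n. ereal (?S n x / n))" using zero_one[of c] by blast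
    then have "AE x in N. \<exists>n. 0 < (\<Sum>i<n. f ((T ^^ i) x) - c)"
    proof eventually_elim
      case (elim x)
      \<comment> \<open>Index 0 is excluded: the quotient there is 0 by convention and says nothing
        about a sum.\<close>
      have "\<exists>n>0. ereal c < ereal (?S n x / real n)"
      proof (rule ccontr)
        assume nex: "\<not> ?thesis"
        have "\<forall>\<^sub>F n in sequentially. ereal (?S n x / n) \<le> ereal c"
        proof (intro eventually_sequentiallyI[of 1])
          fix n :: nat assume "1 \<le> n"
          then have "\<not> ereal c < ereal (?S n x / n)" using nex by (metis less_le_trans zero_less_one)
          then show "ereal (?S n x / n) \<le> ereal c" by (simp only: not_less)
        qed
        then have "limsup (\<lambda>n. ereal (?S n x / n)) \<le> ereal c" by (rule Limsup_bounded)
        with elim show False by simp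
      qed
      then obtain n where "0 < n" "c < ?S n x / n" by auto
      then have "0 < (\<Sum>i<n. f ((T ^^ i) x) - c)" by (simp add: sum_subtractf field_simps)
      then show ?case by blast
    qed
    from maximal_ergodic[OF T inv _ this] f have "0 \<le> (\<integral>x. f x - c \<partial>N)" by simp
    also have "\<dots> = (\<integral>x. f x \<partial>N) - c" using f by (simp add: prob_space)
    finally show False using c by simp
  qed
  have "AE x in N. \<forall>k::nat. limsup (\<lambda>n. ereal (?S n x / n)) \<le> ereal ((\<integral>x. f x \<partial>N) + 1 / Suc k)"
    unfolding AE_all_countable by (intro allI le) simp
  then show ?thesis
  proof eventually_elim
    case (elim x)
    have "(\<lambda>k. ereal ((\<integral>x. f x \<partial>N) + 1 / Suc k)) \<longlonglongrightarrow> ereal ((\<integral>x. f x \<partial>N) + 0)"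
      unfolding lim_ereal by (intro tendsto_add tendsto_const LIMSEQ_Suc lim_1_over_n)
    from LIMSEQ_le_const[OF this[unfolded add_0_right]] show ?case using elim by blast
  qed
qed

section \<open>Shifts and primitives on trajectory space\<close>

lemma space_trajectory_space: "space trajectory_space = {x. continuous_on UNIV x}"
  by (auto simp: trajectory_space_def space_restrict_space space_PiM)

lemma measurable_trajectory_coordinate [measurable]: "(\<lambda>x. x s) \<in> borel_measurable trajectory_space"
  unfolding trajectory_space_def by (intro measurable_restrict_space1 measurable_component_singleton) simp

lemma measurable_trajectory_spaceI:
  assumes "\<And>s. (\<lambda>\<omega>. f \<omega> s) \<in> borel_measurable M" "\<And>\<omega>. \<omega> \<in> space M \<Longrightarrow> continuous_on UNIV (f \<omega>)"
  shows "f \<in> measurable M trajectory_space"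
  unfolding trajectory_space_def
  using assms by (intro measurable_restrict_space2 measurable_PiM_single') (auto simp: space_PiM)

definition shift :: "real \<Rightarrow> (real \<Rightarrow> real) \<Rightarrow> real \<Rightarrow> real" where
  "shift h x = (\<lambda>s. x (s + h))"

lemma continuous_on_shift: "continuous_on UNIV x \<Longrightarrow> continuous_on UNIV (shift h x)"
  unfolding shift_def by (rule continuous_on_compose2[of UNIV x]) (auto intro!: continuous_intros)

lemma measurable_shift [measurable]: "shift h \<in> measurable trajectory_space trajectory_space"
proof (rule measurable_trajectory_spaceI)
  show "(\<lambda>x. shift h x s) \<in> borel_measurable trajectory_space" for s unfolding shift_def by measurable
qed (auto simp: space_trajectory_space continuous_on_shift)

lemma shift_funpow: "(shift h ^^ n) x = shift (n * h) x"
  by (induction n) (auto simp: shift_def algebra_simps)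

text \<open>The cocycle identity that makes Birkhoff sums of the functional
  \<open>\<lambda>x. primitive x \<sigma>\<close> under the shift by \<sigma> telescope to
  \<open>primitive x (n * \<sigma>)\<close>.\<close>

lemma primitive_shift:
  assumes x: "continuous_on UNIV x"
  shows "primitive (shift h x) t = primitive x (t + h) - primitive x h"
proof -
  have "((\<lambda>t. primitive x (t + h)) has_real_derivative shift h x t) (at t)" for t
    unfolding shift_def using DERIV_shift[of "primitive x"] DERIV_primitive[OF x] by blast
  from primitive_unique[OF this continuous_on_shift[OF x]] show ?thesis by simp
qed

text \<open>Riemann sums involve finitely many coordinates of \<open>x\<close>. They are the route
  both to measurability of the primitive as a functional of the trajectory and to its mean. The sign
  of \<open>t\<close> is free, hence closed segments instead of intervals below.\<close>

lemma riemann_sum_tendsto_primitive: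
  assumes x: "continuous_on UNIV x"
  shows "(\<lambda>n::nat. \<Sum>k<n. t / n * x (real k * (t / n))) \<longlonglongrightarrow> primitive x t"
proof (rule LIMSEQ_I)
  fix e :: real assume "0 < e"
  define \<eta> where "\<eta> = e / (2 * (\<bar>t\<bar> + 1))"
  have "0 < \<eta>" using \<open>0 < e\<close> by (simp add: \<eta>_def)
  have "uniformly_continuous_on {-\<bar>t\<bar>..\<bar>t\<bar>} x"
    by (intro compact_uniformly_continuous continuous_on_subset[OF x]) auto
  then obtain d where d: "0 < d" "\<And>u v. u \<in> {-\<bar>t\<bar>..\<bar>t\<bar>} \<Longrightarrow> v \<in> {-\<bar>t\<bar>..\<bar>t\<bar>} \<Longrightarrow> \<bar>u - v\<bar> < d \<Longrightarrow> \<bar>x u - x v\<bar> < \<eta>"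
    unfolding uniformly_continuous_on_def dist_real_def using \<open>0 < \<eta>\<close> by metis
  obtain n0 :: nat where n0: "\<bar>t\<bar> / d < n0" using reals_Archimedean2 by blast
  show "\<exists>n0::nat. \<forall>n\<ge>n0. norm ((\<Sum>k<n. t / n * x (real k * (t / n))) - primitive x t) < e"
  proof (intro exI[of _ "Suc n0"] allI impI)
    fix n assume n: "Suc n0 \<le> n"
    define P where "P = primitive x"
    define s where "s k = real k * (t / n)" for k
    have s1: "s (Suc k) - s k = t / n" for k by (simp add: s_def algebra_simps add_divide_distrib)
    have "\<bar>t\<bar> < d * n0" using n0 d(1) by (simp add: field_simps)
    also have "\<dots> \<le> d * n" using n d(1) by simp
    finally have tn: "\<bar>t / n\<bar> < d" using n by (simp add: field_simps)
    have s_in: "\<bar>s k\<bar> \<le> \<bar>t\<bar>" if "k \<le> n" for k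
      using that n mult_left_mono[of "real k" "real n" "\<bar>t\<bar>"] by (simp add: s_def abs_mult field_simps)
    \<comment> \<open>Mean value bound for the primitive minus its tangent at the left node: the
      derivative of this difference is at most \<eta> on a mesh cell.\<close>
    have step: "\<bar>P (s (Suc k)) - P (s k) - t / n * x (s k)\<bar> \<le> \<eta> * \<bar>t / n\<bar>" if "k < n" for k
    proof -
      let ?C = "closed_segment (s k) (s (Suc k))"
      have "norm ((P (s (Suc k)) - x (s k) * s (Suc k)) - (P (s k) - x (s k) * s k)) \<le> \<eta> * norm (s (Suc k) - s k)"
      proof (rule field_differentiable_bound[of ?C "\<lambda>u. P u - x (s k) * u" "\<lambda>u. x u - x (s k)"])
        show "((\<lambda>u. P u - x (s k) * u) has_real_derivative x u - x (s k)) (at u within ?C)" for u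
          unfolding P_def
          by (auto intro!: derivative_eq_intros DERIV_subset[OF DERIV_primitive[OF x]])
        fix u assume u: "u \<in> ?C"
        have "\<bar>u - s k\<bar> \<le> \<bar>s (Suc k) - s k\<bar>"
          using u by (auto simp: closed_segment_eq_real_ivl split: if_splits)
        then have "\<bar>u - s k\<bar> < d" using tn s1 by simp
        moreover have "\<bar>u\<bar> \<le> \<bar>t\<bar>"
          using u s_in[of k] s_in[of "Suc k"] \<open>k < n\<close> by (auto simp: closed_segment_eq_real_ivl split: if_splits)
        ultimately show "norm (x u - x (s k)) \<le> \<eta>"
          using d(2)[of u "s k"] s_in[of k] \<open>k < n\<close> by (auto simp: abs_le_iff)
      qed auto
      moreover have "(P (s (Suc k)) - x (s k) * s (Suc k)) - (P (s k) - x (s k) * s k)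
          = P (s (Suc k)) - P (s k) - t / n * x (s k)"
        unfolding s1[of k, symmetric] by (simp add: algebra_simps)
      ultimately show ?thesis unfolding real_norm_def s1 by (simp only:)
    qed
    have "primitive x t = P (s n) - P (s 0)"
      using n by (simp add: P_def s_def primitive_0[OF x])
    also have "\<dots> = (\<Sum>k<n. P (s (Suc k)) - P (s k))" by (rule sum_lessThan_telescope[symmetric])
    finally have "norm ((\<Sum>k<n. t / n * x (real k * (t / n))) - primitive x t)
        = \<bar>\<Sum>k<n. P (s (Suc k)) - P (s k) - t / n * x (s k)\<bar>"
      by (simp add: sum_subtractf s_def abs_minus_commute)
    also have "\<dots> \<le> (\<Sum>k<n. \<bar>P (s (Suc k)) - P (s k) - t / n * x (s k)\<bar>)" by (rule sum_abs)
    also have "\<dots> \<le> (\<Sum>k<n. \<eta> * \<bar>t / n\<bar>)" by (intro sum_mono step) simp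
    also have "\<dots> = \<eta> * \<bar>t\<bar>" using n by simp
    also have "\<dots> \<le> \<eta> * (\<bar>t\<bar> + 1)" using \<open>0 < \<eta>\<close> by simp
    also have "\<dots> = e / 2" unfolding \<eta>_def by (simp add: divide_simps add_nonneg_eq_0_iff)
    finally show "norm ((\<Sum>k<n. t / n * x (real k * (t / n))) - primitive x t) < e" using \<open>0 < e\<close> by simp
  qed
qed

text \<open>The primitive is defined by choice, so measurability has to come from a pointwise limit
  of measurable functionals.\<close>

lemma measurable_primitive [measurable]: "(\<lambda>x. primitive x t) \<in> borel_measurable trajectory_space"
proof (rule borel_measurable_LIMSEQ_real)
  show "(\<lambda>n::nat. \<Sum>k<n. t / n * x (real k * (t / n))) \<longlonglongrightarrow> primitive x t"
    if "x \<in> space trajectory_space" for x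
    using that by (intro riemann_sum_tendsto_primitive) (simp add: space_trajectory_space)
  show "(\<lambda>x. \<Sum>k<n. t / n * x (real k * (t / n))) \<in> borel_measurable trajectory_space" for n :: nat
    by measurable
qed


text \<open>A real \<open>x\<close> is within 1 of its integer part, so the Lipschitz bound makes
  the passage from integers to reals cost at most \<open>(K + \<bar>m'\<bar>) / x\<close>. The sign
  \<sigma> treats both ends of the line at once.\<close>

lemma ratio_tendsto_at_infinity:
  fixes L :: "real \<Rightarrow> real"
  assumes L: "\<And>x y. \<bar>L x - L y\<bar> \<le> K * \<bar>x - y\<bar>"
    and pos: "(\<lambda>n. L (real n) / n) \<longlonglongrightarrow> m" and neg: "(\<lambda>n. L (- real n) / n) \<longlonglongrightarrow> - m"
  shows "((\<lambda>x. L x / x) \<longlongrightarrow> m) at_infinity"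
proof -
  have main: "((\<lambda>x. L (\<sigma> * x) / x) \<longlongrightarrow> m') at_top"
    if \<sigma>: "\<bar>\<sigma>\<bar> = 1" and lim: "(\<lambda>n. L (\<sigma> * real n) / n) \<longlonglongrightarrow> m'" for \<sigma> m'
  proof -
    define e where "e n = \<bar>L (\<sigma> * real n) / n - m'\<bar>" for n
    have "e \<longlonglongrightarrow> 0" unfolding e_def using lim by (simp add: tendsto_rabs_zero_iff LIM_zero_iff)
    then have "((\<lambda>x. e (nat \<lfloor>x\<rfloor>)) \<longlongrightarrow> 0) at_top"
      by (rule filterlim_compose) (rule filterlim_compose[OF filterlim_nat_sequentially filterlim_floor_sequentially])
    moreover have "((\<lambda>x. (K + \<bar>m'\<bar>) / x) \<longlongrightarrow> 0) at_top"
      by (intro tendsto_divide_0[OF tendsto_const] filterlim_at_top_imp_at_infinity filterlim_ident)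
    ultimately have "((\<lambda>x. (K + \<bar>m'\<bar>) / x + e (nat \<lfloor>x\<rfloor>)) \<longlongrightarrow> 0 + 0) at_top" by (rule tendsto_add[rotated])
    then have lim0: "((\<lambda>x. (K + \<bar>m'\<bar>) / x + e (nat \<lfloor>x\<rfloor>)) \<longlongrightarrow> 0) at_top" by simp
    have "\<forall>\<^sub>F x in at_top. norm (L (\<sigma> * x) / x - m') \<le> (K + \<bar>m'\<bar>) / x + e (nat \<lfloor>x\<rfloor>)"
      using eventually_ge_at_top[of 1]
    proof eventually_elim
      case (elim x)
      define n where "n = nat \<lfloor>x\<rfloor>"
      have n: "1 \<le> real n" "real n \<le> x" "x \<le> real n + 1"
      proof -
        have "real n = of_int \<lfloor>x\<rfloor>" "1 \<le> \<lfloor>x\<rfloor>" using elim by (auto simp: n_def)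
        then show "1 \<le> real n" "real n \<le> x" "x \<le> real n + 1" by linarith+
      qed
      have "0 \<le> K" using L[of 1 0] by simp
      have "\<bar>L (\<sigma> * x) - L (\<sigma> * n)\<bar> \<le> K * (\<bar>\<sigma>\<bar> * \<bar>x - n\<bar>)"
        using L[of "\<sigma> * x" "\<sigma> * n"] by (simp add: abs_mult[symmetric] right_diff_distrib)
      also have "\<dots> \<le> K * 1" using n \<sigma> \<open>0 \<le> K\<close> by (intro mult_left_mono) auto
      finally have 1: "\<bar>L (\<sigma> * x) - L (\<sigma> * n)\<bar> \<le> K" by simp
      have "\<bar>L (\<sigma> * n) - m' * n\<bar> = n * e n"
        using n abs_mult[of n "L (\<sigma> * real n) / n - m'"] by (simp add: e_def algebra_simps)
      also have "\<dots> \<le> x * e n" using n by (intro mult_right_mono) (auto simp: e_def)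
      finally have 2: "\<bar>L (\<sigma> * n) - m' * n\<bar> \<le> x * e n" .
      have "\<bar>m' * n - m' * x\<bar> = \<bar>m'\<bar> * \<bar>n - x\<bar>"
        by (simp add: abs_mult[symmetric] right_diff_distrib)
      also have "\<dots> \<le> \<bar>m'\<bar> * 1" using n by (intro mult_left_mono) auto
      finally have 3: "\<bar>m' * n - m' * x\<bar> \<le> \<bar>m'\<bar>" by simp
      have "\<bar>L (\<sigma> * x) - m' * x\<bar> \<le> K + x * e n + \<bar>m'\<bar>" using 1 2 3 by linarith
      then have "\<bar>L (\<sigma> * x) - m' * x\<bar> / x \<le> (K + x * e n + \<bar>m'\<bar>) / x"
        using elim by (intro divide_right_mono) auto
      moreover have "\<bar>L (\<sigma> * x) / x - m'\<bar> = \<bar>L (\<sigma> * x) - m' * x\<bar> / x"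
        using elim abs_divide[of "L (\<sigma> * x) - m' * x" x] by (simp add: diff_divide_distrib)
      moreover have "(K + x * e n + \<bar>m'\<bar>) / x = (K + \<bar>m'\<bar>) / x + e n"
        using elim by (simp add: field_simps)
      ultimately show ?case unfolding n_def[symmetric] real_norm_def by linarith
    qed
    then show ?thesis by (rule LIM_zero_cancel[OF Lim_null_comparison[OF _ lim0]])
  qed
  have "((\<lambda>x. L x / x) \<longlongrightarrow> m) at_top" using main[of 1 m] pos by simp
  moreover have "((\<lambda>x. L (- x) / x) \<longlongrightarrow> - m) at_top" using main[of "-1" "-m"] neg by simp
  then have "((\<lambda>x. L x / x) \<longlongrightarrow> m) at_bot"
    unfolding filterlim_at_bot_mirror using tendsto_minus[of "\<lambda>x. L (- x) / x" "- m" at_top] by simp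
  ultimately show ?thesis by (simp add: at_infinity_eq_at_top_bot filterlim_sup)
qed

text \<open>At an integer \<open>n\<close> the primitive is exactly \<open>n\<close> times the
  integral over one period, so the ratio at nonzero integers is already the limit.\<close>

lemma periodic_primitive_ratio:
  assumes l: "continuous_on UNIV l" and per: "\<And>x. l (x + 1) = l x" and K: "\<And>x. \<bar>l x\<bar> \<le> K"
  shows "((\<lambda>x. primitive l x / x) \<longlongrightarrow> integral {0..1} l) at_infinity"
proof -
  let ?L = "primitive l"
  have "(l has_integral ?L 1 - ?L 0) {0..1}"
    by (intro fundamental_theorem_of_calculus)
      (auto simp: has_real_derivative_iff_has_vector_derivative[symmetric]
        intro: DERIV_subset[OF DERIV_primitive[OF l]])
  then have m: "integral {0..1} l = ?L 1" by (simp add: integral_unique primitive_0[OF l])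
  have "shift 1 l = l" using per by (auto simp: shift_def)
  then have add: "?L (x + 1) = ?L x + ?L 1" for x using primitive_shift[OF l, of 1 x] by simp
  have n: "?L (real n) = n * ?L 1" for n
  proof (induction n)
    case (Suc n)
    then show ?case using add[of "real n"] by (simp add: algebra_simps)
  qed (simp add: primitive_0[OF l])
  have n': "?L (- real n) = - (n * ?L 1)" for n
  proof (induction n)
    case (Suc n)
    then show ?case using add[of "- 1 - real n"] by (simp add: algebra_simps)
  qed (simp add: primitive_0[OF l])
  show ?thesis unfolding m
  proof (rule ratio_tendsto_at_infinity)
    show "\<bar>?L x - ?L y\<bar> \<le> K * \<bar>x - y\<bar>" for x y
      by (rule DERIV_lipschitz[OF DERIV_primitive[OF l] K])
    show "(\<lambda>n. ?L (real n) / n) \<longlonglongrightarrow> ?L 1"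
      by (rule tendsto_eventually, rule eventually_sequentiallyI[of 1]) (simp add: n)
    show "(\<lambda>n. ?L (- real n) / n) \<longlonglongrightarrow> - ?L 1"
      by (rule tendsto_eventually, rule eventually_sequentiallyI[of 1]) (simp add: n')
  qed
qed

text \<open>The problem is moved to the law \<open>N\<close> of the friction on trajectory space,
  which every shift preserves. The upper bound for Birkhoff averages is applied to the functional
  \<open>\<kappa> * primitive x \<sigma>\<close> with both signs of \<kappa>, giving limsup and
  liminf, and both signs of \<sigma>, giving the two directions.\<close>

lemma ergodic_primitive_ratio:
  assumes "prob_space M" and meas: "\<And>x. lam x \<in> borel_measurable M"
    and cont: "\<And>\<omega>. \<omega> \<in> space M \<Longrightarrow> continuous_on UNIV (\<lambda>x. lam x \<omega>)"
    and bound: "\<And>\<omega> x. \<omega> \<in> space M \<Longrightarrow> \<bar>lam x \<omega>\<bar> \<le> K"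
    and stat: "stationary_process M lam" and erg: "ergodic_process M lam"
    and mean: "\<And>x. (\<integral>\<omega>. lam x \<omega> \<partial>M) = m"
  shows "AE \<omega> in M. ((\<lambda>x. primitive (\<lambda>x. lam x \<omega>) x / x) \<longlongrightarrow> m) at_infinity"
proof -
  interpret prob_space M by fact
  define traj where "traj \<omega> = (\<lambda>x. lam x \<omega>)" for \<omega>
  have traj[measurable]: "traj \<in> measurable M trajectory_space"
    by (rule measurable_trajectory_spaceI) (auto simp: traj_def meas cont)
  have ct: "continuous_on UNIV (traj \<omega>)" if "\<omega> \<in> space M" for \<omega> using cont[OF that] by (simp add: traj_def)
  define N where "N = distr M trajectory_space traj"
  interpret N: prob_space N unfolding N_def by (rule prob_space_distr[OF traj])
  have setsN[measurable_cong]: "sets N = sets trajectory_space" by (simp add: N_def)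
  have spaceN: "space N = {x. continuous_on UNIV x}" by (simp add: N_def space_trajectory_space)
  have T: "shift h \<in> measurable N N" for h by measurable
  have inv: "distr N N (shift h) = N" for h
  proof -
    have "distr N N (shift h) = distr N trajectory_space (shift h)" by (rule distr_cong) (simp_all add: setsN)
    also have "\<dots> = distr M trajectory_space (shift h \<circ> traj)"
      unfolding N_def by (rule distr_distr) measurable
    also have "shift h \<circ> traj = (\<lambda>\<omega> x. lam (x + h) \<omega>)" by (auto simp: traj_def shift_def)
    also have "distr M trajectory_space \<dots> = N"
      using stat unfolding stationary_process_def N_def traj_def[abs_def] by blast
    finally show ?thesis .
  qed
  have lipP: "\<bar>primitive x s - primitive x t\<bar> \<le> K * \<bar>s - t\<bar>"
    if "continuous_on UNIV x" "\<forall>s. \<bar>x s\<bar> \<le> K" for x s t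
    by (rule DERIV_lipschitz[OF DERIV_primitive[OF that(1)]]) (use that in auto)
  have P_bound: "\<bar>primitive (traj \<omega>) t\<bar> \<le> K * \<bar>t\<bar>" if "\<omega> \<in> space M" for \<omega> t
    using lipP[OF ct[OF that], of t 0] bound[OF that] primitive_0[OF ct[OF that]] by (simp add: traj_def)
  have iP: "integrable N (\<lambda>x. primitive x t)" and EP: "(\<integral>x. primitive x t \<partial>N) = t * m" for t
  proof -
    have "integrable M (\<lambda>\<omega>. primitive (traj \<omega>) t)"
      by (rule integrable_const_bound[where B="K * \<bar>t\<bar>"]) (auto intro: AE_I2 P_bound)
    then show "integrable N (\<lambda>x. primitive x t)" unfolding N_def by (subst integrable_distr_eq) auto
    have il: "integrable M (lam x)" for x
      by (rule integrable_const_bound[where B=K]) (auto intro: AE_I2 bound meas)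
    \<comment> \<open>Riemann sums replace an exchange of integrals: for \<open>n\<close> at least 1
      their mean is exactly \<open>t * m\<close>, and \<open>\<bar>t\<bar> * K\<close> dominates
      them.\<close>
    have "(\<lambda>n::nat. \<integral>\<omega>. (\<Sum>k<n. t / n * traj \<omega> (real k * (t / n))) \<partial>M) \<longlonglongrightarrow> (\<integral>\<omega>. primitive (traj \<omega>) t \<partial>M)"
    proof (rule integral_dominated_convergence[where w="\<lambda>_. \<bar>t\<bar> * K"])
      show "(\<lambda>\<omega>. \<Sum>k<n. t / n * traj \<omega> (real k * (t / n))) \<in> borel_measurable M" for n :: nat
        unfolding traj_def using meas by measurable
      show "AE \<omega> in M. (\<lambda>n::nat. \<Sum>k<n. t / n * traj \<omega> (real k * (t / n))) \<longlonglongrightarrow> primitive (traj \<omega>) t"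
        by (intro AE_I2 riemann_sum_tendsto_primitive ct)
      show "AE \<omega> in M. norm (\<Sum>k<n. t / n * traj \<omega> (real k * (t / n))) \<le> \<bar>t\<bar> * K" for n :: nat
      proof (rule AE_I2)
        fix \<omega> assume \<omega>: "\<omega> \<in> space M"
        then have "0 \<le> K" using bound[of \<omega> 0] by linarith
        have "norm (\<Sum>k<n. t / n * traj \<omega> (real k * (t / n))) \<le> (\<Sum>k<n. \<bar>t / n\<bar> * K)"
          using bound[OF \<omega>] by (intro sum_norm_le) (auto simp: traj_def abs_mult intro!: mult_left_mono divide_right_mono)
        also have "\<dots> \<le> \<bar>t\<bar> * K" using \<open>0 \<le> K\<close> by (cases "n = 0") auto
        finally show "norm (\<Sum>k<n. t / n * traj \<omega> (real k * (t / n))) \<le> \<bar>t\<bar> * K" .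
      qed
    qed auto
    moreover have "(\<integral>\<omega>. (\<Sum>k<n. t / n * traj \<omega> (real k * (t / n))) \<partial>M) = t * m" if "1 \<le> n" for n :: nat
      unfolding traj_def using that by (subst Bochner_Integration.integral_sum) (auto simp: il mean)
    then have "(\<lambda>n::nat. \<integral>\<omega>. (\<Sum>k<n. t / n * traj \<omega> (real k * (t / n))) \<partial>M) \<longlonglongrightarrow> t * m"
      by (intro tendsto_eventually eventually_sequentiallyI[of 1])
    ultimately have "(\<integral>\<omega>. primitive (traj \<omega>) t \<partial>M) = t * m" by (rule LIMSEQ_unique)
    then show "(\<integral>x. primitive x t \<partial>N) = t * m" unfolding N_def by (subst integral_distr) auto
  qed
  \<comment> \<open>Rational times make the set measurable, and continuity extends the bound to all
    times. It carries full measure under \<open>N\<close>.\<close>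
  define B where "B = {x \<in> space trajectory_space. \<forall>s\<in>\<rat>. \<bar>x s\<bar> \<le> K}"
  have B_sets[measurable]: "B \<in> sets trajectory_space"
    unfolding B_def by (intro sets.sets_Collect_countable_All' countable_rat) measurable
  have B_all: "\<bar>x s\<bar> \<le> K" if "x \<in> B" for x s
  proof (rule continuous_le_on_closure[where S="\<rat>" and f="\<lambda>s. \<bar>x s\<bar>"])
    show "continuous_on (closure \<rat>) (\<lambda>s. \<bar>x s\<bar>)"
      using that by (auto simp: B_def space_trajectory_space Rats_closure_real intro!: continuous_intros)
  qed (use that in \<open>auto simp: B_def Rats_closure_real\<close>)
  have B_eq: "x \<in> B \<longleftrightarrow> continuous_on UNIV x \<and> (\<forall>s. \<bar>x s\<bar> \<le> K)" for x
    using B_all[of x] by (auto simp: B_def space_trajectory_space)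
  have traj_B: "traj \<omega> \<in> B" if "\<omega> \<in> space M" for \<omega>
    using ct[OF that] bound[OF that] by (simp add: B_eq traj_def)
  have limsup_le: "AE \<omega> in M. limsup (\<lambda>n. ereal (\<kappa> * primitive (traj \<omega>) (real n * \<sigma>) / real n)) \<le> ereal (\<kappa> * (\<sigma> * m))" for \<kappa> \<sigma>
  proof -
    let ?f = "\<lambda>x. \<kappa> * primitive x \<sigma>"
    let ?Z = "\<lambda>x. limsup (\<lambda>n. ereal (\<kappa> * primitive x (real n * \<sigma>) / real n))"
    have sums: "(\<Sum>i<n. ?f ((shift \<sigma> ^^ i) x)) = \<kappa> * primitive x (real n * \<sigma>)" if "x \<in> space N" for x n
    proof -
      have c: "continuous_on UNIV x" using that spaceN by simp
      have "(\<Sum>i<n. ?f ((shift \<sigma> ^^ i) x)) = \<kappa> * (\<Sum>i<n. primitive x (Suc i * \<sigma>) - primitive x (i * \<sigma>))"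
        by (simp add: sum_distrib_left shift_funpow primitive_shift[OF c] algebra_simps)
      also have "(\<Sum>i<n. primitive x (Suc i * \<sigma>) - primitive x (i * \<sigma>)) = primitive x (real n * \<sigma>) - primitive x (0 * \<sigma>)"
        using sum_lessThan_telescope[of "\<lambda>i. primitive x (real i * \<sigma>)" n] by simp
      finally show ?thesis by (simp add: primitive_0[OF c])
    qed
    have "AE x in N. limsup (\<lambda>n. ereal ((\<Sum>i<n. ?f ((shift \<sigma> ^^ i) x)) / real n)) \<le> ereal (\<integral>x. ?f x \<partial>N)"
    proof (rule limsup_birkhoff_average_le[OF N.prob_space_axioms T inv])
      show "integrable N ?f" using iP by simp
      fix c
      \<comment> \<open>Ergodicity demands invariance at every trajectory, not almost every one.
        Intersecting with \<open>B\<close> provides the bound on which invariance of the limsup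
        rests.\<close>
      define A where "A = {x \<in> B. ereal c < ?Z x}"
      have "A = B \<inter> {x \<in> space trajectory_space. ereal c < ?Z x}"
        using sets.sets_into_space[OF B_sets] by (auto simp: A_def)
      also have "\<dots> \<in> sets trajectory_space" by measurable
      finally have A[measurable]: "A \<in> sets trajectory_space" .
      \<comment> \<open>A shift by \<open>h\<close> changes the primitive at
        \<open>n * \<sigma>\<close> by at most \<open>2 * K * \<bar>h\<bar>\<close>, which division
        by \<open>n\<close> sends to 0. This holds for every real \<open>h\<close>, as flow
        invariance requires.\<close>
      have shift_Z: "?Z (shift h x) = ?Z x" if "x \<in> B" for x h
      proof -
        have c: "continuous_on UNIV x" and K: "\<forall>s. \<bar>x s\<bar> \<le> K" using that B_eq by auto
        have "0 \<le> K" using K[rule_format, of 0] by linarith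
        define u where "u n = \<kappa> * (primitive x (real n * \<sigma> + h) - primitive x h - primitive x (real n * \<sigma>)) / real n" for n :: nat
        have "u \<longlonglongrightarrow> 0"
        proof (rule Lim_null_comparison)
          show "\<forall>\<^sub>F n in sequentially. norm (u n) \<le> \<bar>\<kappa>\<bar> * (2 * K * \<bar>h\<bar>) * (1 / real n)"
          proof (rule always_eventually, rule allI)
            fix n
            have "\<bar>primitive x (real n * \<sigma> + h) - primitive x h - primitive x (real n * \<sigma>)\<bar> \<le> 2 * K * \<bar>h\<bar>"
              using lipP[OF c K, of "real n * \<sigma> + h" "real n * \<sigma>"] lipP[OF c K, of h 0] primitive_0[OF c] by simp
            then show "norm (u n) \<le> \<bar>\<kappa>\<bar> * (2 * K * \<bar>h\<bar>) * (1 / real n)"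
              unfolding u_def by (auto simp: abs_mult intro!: divide_right_mono mult_left_mono)
          qed
          show "(\<lambda>n. \<bar>\<kappa>\<bar> * (2 * K * \<bar>h\<bar>) * (1 / real n)) \<longlonglongrightarrow> 0"
            by (intro tendsto_mult_right_zero lim_1_over_n)
        qed
        then have u: "(\<lambda>n. ereal (u n)) \<longlonglongrightarrow> ereal 0" by (simp only: lim_ereal)
        have "?Z (shift h x) = limsup (\<lambda>n. ereal (u n) + ereal (\<kappa> * primitive x (real n * \<sigma>) / real n))"
          by (simp add: primitive_shift[OF c] u_def add_divide_distrib[symmetric] algebra_simps)
        also have "\<dots> = ereal 0 + ?Z x" by (rule ereal_limsup_lim_add[OF u]) simp
        finally show ?thesis by (simp add: zero_ereal_def[symmetric])
      qed
      have "(\<lambda>s. x (s + h)) \<in> A \<longleftrightarrow> x \<in> A" if "x \<in> space trajectory_space" for x h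
      proof -
        have B: "shift h x \<in> B \<longleftrightarrow> x \<in> B" for h and x
        proof -
          have "shift h x \<in> B" if "x \<in> B" for x h
            using that continuous_on_shift[of x h] by (auto simp: B_eq shift_def)
          from this[of x h] this[of "shift h x" "-h"] show ?thesis by (auto simp: shift_def)
        qed
        show ?thesis using B[of h x] shift_Z[of x h] unfolding A_def shift_def by auto
      qed
      then have "measure M {\<omega> \<in> space M. traj \<omega> \<in> A} \<in> {0, 1}"
        using erg A unfolding ergodic_process_def traj_def[abs_def] by blast
      moreover have "measure M {\<omega> \<in> space M. traj \<omega> \<in> A} = measure N A"
        unfolding N_def using measure_distr[OF traj A] by (simp add: vimage_def Int_def conj_commute)
      ultimately have "measure N A = 0 \<or> measure N A = 1" by simp
      moreover have "AE x in N. x \<in> B"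
        unfolding N_def by (subst AE_distr_iff) (auto intro!: AE_I2 traj_B)
      moreover have "AE x in N. ereal c < ?Z x" if "measure N A = 1"
        using N.AE_prob_1[OF that] by eventually_elim (simp add: A_def)
      moreover have "AE x in N. x \<notin> A" if "measure N A = 0"
        using that by (intro AE_not_in) (simp add: N.emeasure_eq_measure null_sets_def setsN)
      ultimately show "(AE x in N. ereal c < limsup (\<lambda>n. ereal ((\<Sum>i<n. ?f ((shift \<sigma> ^^ i) x)) / real n))) \<or>
         (AE x in N. limsup (\<lambda>n. ereal ((\<Sum>i<n. ?f ((shift \<sigma> ^^ i) x)) / real n)) \<le> ereal c)"
      proof (elim disjE)
        assume "measure N A = 0" "AE x in N. x \<in> B" "measure N A = 0 \<Longrightarrow> AE x in N. x \<notin> A"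
        from this(2) this(3)[OF this(1)] AE_space
        have "AE x in N. limsup (\<lambda>n. ereal ((\<Sum>i<n. ?f ((shift \<sigma> ^^ i) x)) / real n)) \<le> ereal c"
          by eventually_elim (auto simp: A_def sums not_less)
        then show ?thesis ..
      next
        assume "measure N A = 1" "measure N A = 1 \<Longrightarrow> AE x in N. ereal c < ?Z x"
        from this(2)[OF this(1)] AE_space
        have "AE x in N. ereal c < limsup (\<lambda>n. ereal ((\<Sum>i<n. ?f ((shift \<sigma> ^^ i) x)) / real n))"
          by eventually_elim (simp add: sums)
        then show ?thesis ..
      qed
    qed
    then have "AE x in N. ?Z x \<le> ereal (\<integral>x. ?f x \<partial>N)"
      using AE_space by eventually_elim (simp add: sums)
    then have "AE x in N. ?Z x \<le> ereal (\<kappa> * (\<sigma> * m))" by (simp add: EP)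
    then show ?thesis unfolding N_def by (rule AE_distrD[OF traj])
  qed
  show ?thesis
    \<comment> \<open>The four sign patterns: the first argument is \<kappa>, the second
      \<sigma>.\<close>
    using limsup_le[of 1 1] limsup_le[of "-1" 1] limsup_le[of 1 "-1"] limsup_le[of "-1" "-1"] AE_space
  proof eventually_elim
    case (elim \<omega>)
    let ?L = "primitive (traj \<omega>)"
    have conv: "v \<longlonglongrightarrow> a" if "limsup (\<lambda>n. ereal (v n)) \<le> ereal a" "limsup (\<lambda>n. ereal (- v n)) \<le> ereal (- a)" for v a
    proof -
      have "ereal a \<le> liminf (\<lambda>n. ereal (v n))"
        using that(2) ereal_Limsup_uminus[of sequentially "\<lambda>n. ereal (v n)"]
        by (simp add: ereal_minus_le_minus flip: uminus_ereal.simps(1))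
      then have "(\<lambda>n. ereal (v n)) \<longlonglongrightarrow> ereal a"
        using that(1) Liminf_le_Limsup[of sequentially "\<lambda>n. ereal (v n)"]
        unfolding tendsto_iff_Liminf_eq_Limsup[OF trivial_limit_sequentially] by auto
      then show ?thesis by (simp only: lim_ereal)
    qed
    have "((\<lambda>x. ?L x / x) \<longlongrightarrow> m) at_infinity"
    proof (rule ratio_tendsto_at_infinity)
      show "\<bar>?L x - ?L y\<bar> \<le> K * \<bar>x - y\<bar>" for x y
        using traj_B[OF elim(5)] by (intro lipP) (auto simp: B_eq)
      show "(\<lambda>n. ?L (real n) / real n) \<longlonglongrightarrow> m" by (rule conv) (use elim in auto)
      show "(\<lambda>n. ?L (- real n) / real n) \<longlonglongrightarrow> - m" by (rule conv) (use elim in auto)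
    qed
    then show ?case by (simp add: traj_def)
  qed
qed

section \<open>The three limits\<close>

text \<open>Every approximating path is asked to solve the limit equation's own \<open>L\<close>,
  with all discrepancy placed in its forcing; stability then applies sample point by sample
  point.\<close>

lemma integral_solution_weakly_converges:
  fixes X :: "real \<Rightarrow> real \<Rightarrow> 'a \<Rightarrow> real" and L F :: "'a \<Rightarrow> real \<Rightarrow> real"
  assumes "prob_space M" "0 < T" and S: "at 0 within S = at_right 0"
    and X: "\<And>i. i \<in> S \<Longrightarrow> continuous_process M (X i)" and Y: "continuous_process M Y"
    and "0 < c" and L: "\<And>\<omega> x y. \<omega> \<in> space M \<Longrightarrow> c * \<bar>x - y\<bar> \<le> \<bar>L \<omega> x - L \<omega> y\<bar>"
    and "0 \<le> K" and b: "\<And>x y. \<bar>b x - b y\<bar> \<le> K * \<bar>x - y\<bar>" and cb: "continuous_on UNIV b"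
    and approx: "\<And>I. (\<And>n. I n \<in> S - {0}) \<Longrightarrow> I \<longlonglongrightarrow> 0 \<Longrightarrow> AE \<omega> in M. \<exists>Fs.
      (\<forall>n. integral_solution b (L \<omega>) q (Fs n) (\<lambda>t. X (I n) t \<omega>)) \<and>
      (\<forall>T. uniform_limit {0..T} Fs (F \<omega>) sequentially)"
    and sol: "AE \<omega> in M. integral_solution b (L \<omega>) q (F \<omega>) (\<lambda>t. Y t \<omega>)"
  shows "weakly_converges (path_topology T) (\<lambda>i. path_law M T (X i)) (path_law M T Y) (at_right 0)"
proof (rule weakly_converges_pathwise[OF assms(1,2) S X Y])
  fix I assume I: "\<And>n :: nat. I n \<in> S - {0}" "I \<longlonglongrightarrow> 0"
  show "AE \<omega> in M. uniform_limit {0..T} (\<lambda>n t. X (I n) t \<omega>) (\<lambda>t. Y t \<omega>) sequentially"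
    using approx[OF I] sol AE_space
  proof eventually_elim
    case (elim \<omega>)
    then obtain Fs where "\<And>n. integral_solution b (L \<omega>) q (Fs n) (\<lambda>t. X (I n) t \<omega>)"
      "uniform_limit {0..T} Fs (F \<omega>) sequentially" by blast
    from integral_solution_tendsto[OF \<open>0 < c\<close> L[OF elim(3)] \<open>0 \<le> K\<close> b cb this(1) elim(2) this(2)]
    show ?case .
  qed
qed

text \<open>The limit process is built along one sequence of parameters, but its integral equation
  determines it through stability, so the approximations along any other sequence approach the same
  process.\<close>

lemma integral_solution_process_limit:
  fixes X :: "real \<Rightarrow> real \<Rightarrow> 'a \<Rightarrow> real" and L F :: "'a \<Rightarrow> real \<Rightarrow> real"
  assumes "prob_space M"
    and X: "\<And>i. 0 < i \<Longrightarrow> continuous_process M (X i)"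
    and "0 < c" and L: "\<And>\<omega> x y. \<omega> \<in> space M \<Longrightarrow> c * \<bar>x - y\<bar> \<le> \<bar>L \<omega> x - L \<omega> y\<bar>"
    and cL: "\<And>\<omega>. \<omega> \<in> space M \<Longrightarrow> continuous_on UNIV (L \<omega>)"
    and "0 \<le> K" and b: "\<And>x y. \<bar>b x - b y\<bar> \<le> K * \<bar>x - y\<bar>" and cb: "continuous_on UNIV b"
    and approx: "\<And>I. (\<And>n. 0 < I n) \<Longrightarrow> I \<longlonglongrightarrow> 0 \<Longrightarrow> AE \<omega> in M. \<exists>Fs.
      (\<forall>n. integral_solution b (L \<omega>) q (Fs n) (\<lambda>t. X (I n) t \<omega>)) \<and>
      (\<forall>T. uniform_limit {0..T} Fs (F \<omega>) sequentially)"
  shows "\<exists>Y. continuous_process M Y \<and>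
    (AE \<omega> in M. integral_solution b (L \<omega>) q (F \<omega>) (\<lambda>t. Y t \<omega>)) \<and>
    (\<forall>T>0. weakly_converges (path_topology T) (\<lambda>i. path_law M T (X i)) (path_law M T Y) (at_right 0))"
proof -
  define J where "J n = 1 / real (Suc n)" for n
  have J: "0 < J n" "J \<longlonglongrightarrow> 0" for n
    unfolding J_def by (auto intro: LIMSEQ_Suc lim_1_over_n simp del: of_nat_Suc)
  \<comment> \<open>\<open>lim\<close> is total, so \<open>Z\<close> is measurable even where the
    sequence fails to converge; its paths there are repaired by the modification below.\<close>
  define Z where "Z t \<omega> = lim (\<lambda>n. X (J n) t \<omega>)" for t \<omega>
  have Zm: "Z t \<in> borel_measurable M" if "0 \<le> t" for t
  proof -
    have "X (J n) t \<in> borel_measurable M" for n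
      using X[OF J(1)] that by (auto simp: continuous_process_def)
    then show ?thesis unfolding Z_def[abs_def] by (rule borel_measurable_lim_metric)
  qed
  have Zsol: "AE \<omega> in M. integral_solution b (L \<omega>) q (F \<omega>) (\<lambda>t. Z t \<omega>)"
    using approx[OF J] AE_space
  proof eventually_elim
    case (elim \<omega>)
    then obtain Fs where "\<And>n. integral_solution b (L \<omega>) q (Fs n) (\<lambda>t. X (J n) t \<omega>)"
      "\<And>T. uniform_limit {0..T} Fs (F \<omega>) sequentially" by blast
    from integral_solution_limit[OF \<open>0 < c\<close> L[OF elim(2)] cL[OF elim(2)] \<open>0 \<le> K\<close> b cb this]
    show ?case by (simp add: Z_def)
  qed
  then have "AE \<omega> in M. continuous_on {0..} (\<lambda>t. Z t \<omega>)"
    by eventually_elim (simp add: integral_solution_def)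
  from continuous_process_modification[OF Zm this] obtain Y
    where Y: "continuous_process M Y" "AE \<omega> in M. \<forall>t. Y t \<omega> = Z t \<omega>" by blast
  have sol: "AE \<omega> in M. integral_solution b (L \<omega>) q (F \<omega>) (\<lambda>t. Y t \<omega>)"
    using Y(2) Zsol by eventually_elim simp
  have "weakly_converges (path_topology T) (\<lambda>i. path_law M T (X i)) (path_law M T Y) (at_right 0)"
    if "0 < T" for T
    by (rule integral_solution_weakly_converges[OF assms(1) that refl _ Y(1) \<open>0 < c\<close> L \<open>0 \<le> K\<close> b cb _ sol])
      (use X approx in auto)
  with Y sol show ?thesis by blast
qed

text \<open>With \<delta> and the sample point fixed, the derivative of the mollified path is
  bounded on each \<open>{0..T}\<close> by some \<open>C T\<close>, so the inertial error is at most
  \<open>I n * A T\<close> and tends to 0.\<close>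

lemma langevin_approximation:
  fixes W :: "real \<Rightarrow> 'a \<Rightarrow> real" and b l L :: "real \<Rightarrow> real"
  assumes rho: "mollifier \<rho>" and W: "continuous_on {0..} (\<lambda>t. W t \<omega>)" and "0 < \<delta>" "0 < c"
    and L: "\<And>y. (L has_real_derivative l y) (at y)" and l: "\<And>y. c \<le> l y"
    and B: "\<And>y. \<bar>b y\<bar> \<le> B" and I: "\<And>n. 0 < I n" "I \<longlonglongrightarrow> 0"
    and xs: "\<And>n. langevin_solution (I n) b l (deriv (\<lambda>t. mollified \<rho> \<delta> W t \<omega>)) q p (xs n)"
  shows "\<exists>Fs. (\<forall>n. integral_solution b L q (Fs n) (xs n)) \<and>
    (\<forall>T. uniform_limit {0..T} Fs (\<lambda>t. mollified \<rho> \<delta> W t \<omega> - mollified \<rho> \<delta> W 0 \<omega>) sequentially)"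
proof -
  let ?m = "\<lambda>t. mollified \<rho> \<delta> W t \<omega>"
  have "\<exists>C. \<forall>t\<in>{0..T}. \<bar>deriv ?m t\<bar> \<le> C" for T
  proof -
    have "bounded (deriv ?m ` {0..T})"
      by (intro compact_imp_bounded compact_continuous_image DERIV_mollified(2)[where W=W and \<omega>=\<omega>, OF rho W \<open>0 < \<delta>\<close>]) simp
    then show ?thesis by (auto simp: bounded_iff)
  qed
  then obtain C where C: "\<And>t T. t \<in> {0..T} \<Longrightarrow> \<bar>deriv ?m t\<bar> \<le> C T" by metis
  define A where "A T = 2 * \<bar>p\<bar> + (B + C T) / c" for T
  have "\<exists>G. integral_solution b L q G (xs n) \<and>
      (\<forall>T. \<forall>t\<in>{0..T}. \<bar>G t - (?m t - ?m 0)\<bar> \<le> I n * A T)" for n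
  proof (rule langevin_integral_solution[where C=C, OF xs[of n] I(1)[of n] \<open>0 < c\<close> L l
        DERIV_mollified(1)[where W=W and \<omega>=\<omega>, OF rho W \<open>0 < \<delta>\<close>] C B])
    fix G assume "integral_solution b L q G (xs n)"
      "\<And>t T. t \<in> {0..T} \<Longrightarrow> \<bar>G t - (?m t - ?m 0)\<bar> \<le> I n * (2 * \<bar>p\<bar> + (B + C T) / c)"
    then show ?thesis unfolding A_def by blast
  qed
  then obtain Fs where Fs: "\<And>n. integral_solution b L q (Fs n) (xs n)"
    "\<And>n T t. t \<in> {0..T} \<Longrightarrow> \<bar>Fs n t - (?m t - ?m 0)\<bar> \<le> I n * A T" by metis
  have "uniform_limit {0..T} Fs (\<lambda>t. ?m t - ?m 0) sequentially" for T
  proof (rule uniform_limitI)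
    fix e :: real assume "0 < e"
    have "(\<lambda>n. I n * A T) \<longlonglongrightarrow> 0" by (intro tendsto_mult_left_zero I)
    then have "\<forall>\<^sub>F n in sequentially. I n * A T < e" using \<open>0 < e\<close> by (rule order_tendstoD)
    then show "\<forall>\<^sub>F n in sequentially. \<forall>t\<in>{0..T}. dist (Fs n t) (?m t - ?m 0) < e"
    proof eventually_elim
      case (elim n)
      show ?case using order_le_less_trans[OF Fs(2) elim] by (auto simp: dist_real_def)
    qed
  qed
  with Fs(1) show ?thesis by blast
qed

text \<open>The oscillating primitive is replaced by its linear limit, and the difference, evaluated
  along the solution and at \<open>q\<close>, is moved to the forcing. It is small only locally
  uniformly in space, hence the need for a bound on the solutions that is uniform in
  \<open>n\<close>.\<close>

lemma homogenization_approximation: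
  fixes L :: "real \<Rightarrow> real" and b w :: "real \<Rightarrow> real"
  assumes w: "continuous_on {0..} w" and "0 < c"
    and L: "\<And>x. (L has_real_derivative l x) (at x)" and L0: "L 0 = 0"
    and l: "\<And>x. c \<le> l x" "\<And>x. \<bar>l x\<bar> \<le> K"
    and lim: "((\<lambda>x. L x / x) \<longlongrightarrow> m) at_infinity" and B: "\<And>y. \<bar>b y\<bar> \<le> B" and cb: "continuous_on UNIV b"
    and I: "\<And>n. 0 < I n" "I \<longlonglongrightarrow> 0"
    and xs: "\<And>n. integral_solution b (\<lambda>x. I n * L (x / I n)) q w (xs n)"
  shows "\<exists>Fs. (\<forall>n. integral_solution b (\<lambda>x. m * x) q (Fs n) (xs n)) \<and>
    (\<forall>T. uniform_limit {0..T} Fs w sequentially)"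
proof -
  let ?L = "\<lambda>n x. I n * L (x / I n)"
  define Fs where "Fs n t = w t + (m * xs n t - ?L n (xs n t)) - (m * q - ?L n q)" for n t
  have "integral_solution b (\<lambda>x. m * x) q (Fs n) (xs n)" for n
    using xs[of n] by (auto simp: integral_solution_def Fs_def)
  moreover have "uniform_limit {0..T} Fs w sequentially" for T
  proof (rule uniform_limitI)
    fix e :: real assume "0 < e"
    have "bounded (w ` {0..T})"
      by (intro compact_imp_bounded compact_continuous_image continuous_on_subset[OF w]) auto
    then obtain D where "\<forall>t\<in>{0..T}. \<bar>w t\<bar> \<le> D" by (auto simp: bounded_iff)
    then have D: "\<And>t. t \<in> {0..T} \<Longrightarrow> \<bar>w t\<bar> \<le> D" by blast
    \<comment> \<open>Expansivity gives \<open>c * \<bar>xs n t - q\<bar> \<le> B * T + D\<close>,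
      with a \<open>c\<close> unaffected by rescaling.\<close>
    define R where "R = \<bar>q\<bar> + (B * T + D) / c"
    have xR: "xs n t \<in> {-R..R}" and qR: "q \<in> {-R..R}" if t: "t \<in> {0..T}" for n t
    proof -
      have "0 \<le> B" using B[of 0] by linarith
      have D0: "0 \<le> D" using D[OF t] by linarith
      have dL: "(?L n has_real_derivative l (x / I n)) (at x)" for x
        using I(1)[of n] by (auto intro!: derivative_eq_intros DERIV_chain2[OF L])
      have "c * \<bar>xs n t - q\<bar> \<le> \<bar>?L n (xs n t) - ?L n q\<bar>"
        by (rule DERIV_expansive[OF dL]) (use l \<open>0 < c\<close> in auto)
      also have "?L n (xs n t) - ?L n q = integral {0..t} (\<lambda>s. b (xs n s)) + w t"
        using xs[of n] t by (auto simp: integral_solution_def)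
      also have "norm (integral {0..t} (\<lambda>s. b (xs n s))) \<le> B * (t - 0)"
      proof (rule integral_bound)
        show "continuous_on {0..t} (\<lambda>s. b (xs n s))"
          using xs[of n] by (intro continuous_on_compose2[OF cb])
            (auto simp: integral_solution_def intro: continuous_on_subset)
      qed (use t B in auto)
      then have "\<bar>integral {0..t} (\<lambda>s. b (xs n s)) + w t\<bar> \<le> B * t + D" using D[OF t] by simp
      also have "B * t \<le> B * T" using t \<open>0 \<le> B\<close> by (intro mult_left_mono) auto
      finally have "\<bar>xs n t - q\<bar> \<le> (B * T + D) / c" using \<open>0 < c\<close> by (simp add: field_simps)
      then show "xs n t \<in> {-R..R}" by (auto simp: R_def)
      have "0 \<le> (B * T + D) / c" using t \<open>0 \<le> B\<close> D0 \<open>0 < c\<close> by simp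
      then show "q \<in> {-R..R}" by (auto simp: R_def)
    qed
    have "filterlim I (at_right 0) sequentially"
      by (intro tendsto_imp_filterlim_at_right always_eventually allI I)
    then have "uniform_limit {-R..R} (\<lambda>n x. ?L n x) (\<lambda>x. m * x) sequentially"
      by (rule filterlim_compose[OF rescaled_primitive_tendsto[OF DERIV_lipschitz[OF L l(2)] L0 lim]])
    from uniform_limitD[OF this half_gt_zero[OF \<open>0 < e\<close>]]
    show "\<forall>\<^sub>F n in sequentially. \<forall>t\<in>{0..T}. dist (Fs n t) (w t) < e"
    proof eventually_elim
      case (elim n)
      show ?case
      proof
        fix t assume t: "t \<in> {0..T}"
        have "\<bar>?L n (xs n t) - m * xs n t\<bar> < e / 2" "\<bar>?L n q - m * q\<bar> < e / 2"
          using elim xR[OF t] qR[OF t] by (auto simp: dist_real_def)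
        then show "dist (Fs n t) (w t) < e" unfolding Fs_def dist_real_def by linarith
      qed
    qed
  qed
  ultimately show ?thesis by blast
qed

text \<open>Both kinds of friction enter the limits only through these facts. The bound
  \<open>c \<le> lbar\<close> lets one constant serve as expansion rate for the linear limit as
  well.\<close>

lemma friction_law_of_large_numbers:
  assumes "prob_space M"
    and fr: "(\<exists>l. (\<forall>\<omega>\<in>space M. \<forall>x. lam x \<omega> = l x) \<and> periodic_friction l \<and> lbar = integral {0..1} l) \<or>
         (random_friction M W lam \<and> (\<forall>x. lbar = (\<integral>\<omega>. lam x \<omega> \<partial>M)))"
  obtains c K where "0 < c" "c \<le> lbar"
    "\<And>\<omega>. \<omega> \<in> space M \<Longrightarrow> continuous_on UNIV (\<lambda>x. lam x \<omega>)"
    "\<And>\<omega> x. \<omega> \<in> space M \<Longrightarrow> c \<le> lam x \<omega> \<and> \<bar>lam x \<omega>\<bar> \<le> K"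
    "AE \<omega> in M. ((\<lambda>x. primitive (\<lambda>x. lam x \<omega>) x / x) \<longlongrightarrow> lbar) at_infinity"
  using fr
proof (elim disjE exE conjE)
  fix l assume l: "\<forall>\<omega>\<in>space M. \<forall>x. lam x \<omega> = l x" "periodic_friction l" and m: "lbar = integral {0..1} l"
  then have cl: "continuous_on UNIV l" and pos: "\<And>x. 0 < l x" and per: "\<And>x. l (x + 1) = l x"
    by (auto simp: periodic_friction_def intro: C1_differentiable_imp_continuous_on)
  \<comment> \<open>Invariance under all integers reduces every value of \<open>l\<close> to one at
    a fractional part, so the extrema over \<open>{0..1}\<close> are global; the positive minimum
    becomes \<open>c\<close>.\<close>
  have perz: "l (x + of_int n) = l x" for x n
  proof -
    have *: "l (x + real k) = l x" for x k
    proof (induction k)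
      case (Suc k)
      then show ?case using per[of "x + real k"] by (simp add: algebra_simps)
    qed simp
    show ?thesis
    proof (cases "0 \<le> n")
      case True
      then show ?thesis using *[of x "nat n"] by simp
    next
      case False
      then show ?thesis using *[of "x + of_int n" "nat (- n)"] by simp
    qed
  qed
  have frac: "l x = l (frac x)" "frac x \<in> {0..1}" for x
    using perz[of x "- \<lfloor>x\<rfloor>"] frac_lt_1[of x] by (auto simp: frac_def less_imp_le)
  have c01: "continuous_on {0..1} l" using cl by (rule continuous_on_subset) simp
  obtain u where u: "\<forall>x\<in>{0..1}. l u \<le> l x"
    using continuous_attains_inf[OF _ _ c01] by auto
  obtain v where v: "\<forall>x\<in>{0..1}. l x \<le> l v"
    using continuous_attains_sup[OF _ _ c01] by auto
  have bd: "l u \<le> l x" "l x \<le> l v" for x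
    using u[rule_format, OF frac(2)[of x]] v[rule_format, OF frac(2)[of x]]
    by (simp_all add: frac(1)[of x, symmetric])
  have "integral {0..1::real} (\<lambda>_. l u) \<le> integral {0..1} l"
    by (rule integral_le) (auto intro!: integrable_continuous_real c01 bd)
  then have "l u \<le> lbar" by (simp add: m)
  show thesis
  proof (rule that[of "l u" "l v"])
    show "AE \<omega> in M. ((\<lambda>x. primitive (\<lambda>x. lam x \<omega>) x / x) \<longlongrightarrow> lbar) at_infinity"
    proof (rule AE_I2)
      fix \<omega> assume "\<omega> \<in> space M"
      then have "(\<lambda>x. lam x \<omega>) = l" using l by auto
      then show "((\<lambda>x. primitive (\<lambda>x. lam x \<omega>) x / x) \<longlongrightarrow> lbar) at_infinity"
        unfolding m by (simp only:) (rule periodic_primitive_ratio[OF cl per, of "l v"],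
          use pos bd in \<open>simp add: abs_of_pos\<close>)
    qed
  qed (use l cl pos bd \<open>l u \<le> lbar\<close> in \<open>auto simp: abs_of_pos\<close>)
next
  assume r: "random_friction M W lam" and m: "\<forall>x. lbar = (\<integral>\<omega>. lam x \<omega> \<partial>M)"
  interpret prob_space M by fact
  from r obtain l1 l2 where l12: "0 < l1" "\<And>\<omega> x. \<omega> \<in> space M \<Longrightarrow> l1 \<le> lam x \<omega> \<and> lam x \<omega> \<le> l2"
    unfolding random_friction_def by blast
  from r have meas: "\<And>x. lam x \<in> borel_measurable M"
    and cont: "\<And>\<omega>. \<omega> \<in> space M \<Longrightarrow> continuous_on UNIV (\<lambda>x. lam x \<omega>)"
    and stat: "stationary_process M lam" and erg: "ergodic_process M lam"
    by (auto simp: random_friction_def intro: C1_differentiable_imp_continuous_on)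
  have bd: "\<bar>lam x \<omega>\<bar> \<le> l2" if "\<omega> \<in> space M" for \<omega> x using l12(1) l12(2)[OF that, of x] by linarith
  have "integrable M (lam 0)"
    by (rule integrable_const_bound[where B=l2]) (auto intro: AE_I2 bd meas)
  then have "l1 \<le> lbar" unfolding m[rule_format, of 0] using l12(2)
    by (intro integral_ge_const) (auto intro: AE_I2)
  show thesis
  proof (rule that[OF l12(1) \<open>l1 \<le> lbar\<close> cont])
    show "AE \<omega> in M. ((\<lambda>x. primitive (\<lambda>x. lam x \<omega>) x / x) \<longlongrightarrow> lbar) at_infinity"
      by (rule ergodic_primitive_ratio[OF \<open>prob_space M\<close> meas cont bd stat erg]) (use m in auto)
  qed (use l12 bd in auto)
qed

theorem theorem4p2:
  fixes M :: "'a measure"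
    and W :: "real \<Rightarrow> 'a \<Rightarrow> real"
    and b \<rho> :: "real \<Rightarrow> real"
    and lam :: "real \<Rightarrow> 'a \<Rightarrow> real"
    and lbar q p :: real
    and Q :: "real \<Rightarrow> real \<Rightarrow> real \<Rightarrow> real \<Rightarrow> 'a \<Rightarrow> real"
    and Qbar :: "real \<Rightarrow> 'a \<Rightarrow> real"
  assumes "wiener_process M W"
    and "mollifier \<rho>"
    and "b C1_differentiable_on UNIV" and "bounded (range b)" and "bounded (range (deriv b))"
    and "(\<exists>l. (\<forall>\<omega>\<in>space M. \<forall>x. lam x \<omega> = l x) \<and> periodic_friction l \<and> lbar = integral {0..1} l) \<or>
         (random_friction M W lam \<and> (\<forall>x. lbar = (\<integral>\<omega>. lam x \<omega> \<partial>M)))"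
    and "\<And>\<mu> \<delta> \<epsilon>. 0 < \<mu> \<Longrightarrow> 0 < \<delta> \<Longrightarrow> \<epsilon> \<in> {0<..1} \<Longrightarrow> continuous_process M (Q \<mu> \<delta> \<epsilon>)"
    and "\<And>\<mu> \<delta> \<epsilon>. 0 < \<mu> \<Longrightarrow> 0 < \<delta> \<Longrightarrow> \<epsilon> \<in> {0<..1} \<Longrightarrow>
           AE \<omega> in M. langevin_solution \<mu> b (\<lambda>x. lam (x / \<epsilon>) \<omega>)
             (deriv (\<lambda>t. mollified \<rho> \<delta> W t \<omega>)) q p (\<lambda>t. Q \<mu> \<delta> \<epsilon> t \<omega>)"
    and "continuous_process M Qbar"
    and "AE \<omega> in M. averaged_solution b lbar (\<lambda>t. W t \<omega>) q (\<lambda>t. Qbar t \<omega>)"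
  shows "iterated_weak_limit M Q Qbar"
proof -
  note rho = \<open>mollifier \<rho>\<close> and Qc = assms(7) and Qsol = assms(8)
  have P: "prob_space M" and W0: "AE \<omega> in M. W 0 \<omega> = 0"
    and Wc: "AE \<omega> in M. continuous_on {0..} (\<lambda>t. W t \<omega>)"
    using assms(1) by (simp_all add: wiener_process_def)
  have db: "(b has_real_derivative deriv b x) (at x)" for x
    using assms(3) by (auto simp: C1_differentiable_on_eq DERIV_deriv_iff_real_differentiable)
  have cb: "continuous_on UNIV b" using assms(3) by (rule C1_differentiable_imp_continuous_on)
  obtain B where B: "\<And>y. \<bar>b y\<bar> \<le> B" using assms(4) by (auto simp: bounded_iff)
  obtain Kb where Kb: "\<And>y. \<bar>deriv b y\<bar> \<le> Kb" using assms(5) by (auto simp: bounded_iff)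
  have "0 \<le> Kb" using Kb[of 0] by linarith
  have lipb: "\<bar>b x - b y\<bar> \<le> Kb * \<bar>x - y\<bar>" for x y by (rule DERIV_lipschitz[OF db Kb])
  obtain c K where c: "0 < c" "c \<le> lbar"
    and lc: "\<And>\<omega>. \<omega> \<in> space M \<Longrightarrow> continuous_on UNIV (\<lambda>x. lam x \<omega>)"
    and lbd: "\<And>\<omega> x. \<omega> \<in> space M \<Longrightarrow> c \<le> lam x \<omega> \<and> \<bar>lam x \<omega>\<bar> \<le> K"
    and lln: "AE \<omega> in M. ((\<lambda>x. primitive (\<lambda>x. lam x \<omega>) x / x) \<longlongrightarrow> lbar) at_infinity"
    by (rule friction_law_of_large_numbers[OF P assms(6)]) (rule that)
  define \<Lambda> where "\<Lambda> \<omega> = primitive (\<lambda>x. lam x \<omega>)" for \<omega>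
  define L where "L \<epsilon> \<omega> x = \<epsilon> * \<Lambda> \<omega> (x / \<epsilon>)" for \<epsilon> \<omega> x
  have d\<Lambda>: "(\<Lambda> \<omega> has_real_derivative lam x \<omega>) (at x)" if "\<omega> \<in> space M" for \<omega> x
    unfolding \<Lambda>_def by (rule DERIV_primitive[OF lc[OF that]])
  have dL: "(L \<epsilon> \<omega> has_real_derivative lam (x / \<epsilon>) \<omega>) (at x)" if "0 < \<epsilon>" "\<omega> \<in> space M" for \<epsilon> \<omega> x
    unfolding L_def[abs_def] using that by (auto intro!: derivative_eq_intros DERIV_chain2[OF d\<Lambda>])
  have L: "c * \<bar>x - y\<bar> \<le> \<bar>L \<epsilon> \<omega> x - L \<epsilon> \<omega> y\<bar>" if "0 < \<epsilon>" "\<omega> \<in> space M" for \<epsilon> \<omega> x y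
    by (rule DERIV_expansive[OF dL[OF that]]) (use lbd that c in auto)
  have cL: "continuous_on UNIV (L \<epsilon> \<omega>)" if "0 < \<epsilon>" "\<omega> \<in> space M" for \<epsilon> \<omega>
    using dL[OF that] by (intro DERIV_continuous_on) auto
  let ?m = "\<lambda>\<delta> \<omega> t. mollified \<rho> \<delta> W t \<omega> - mollified \<rho> \<delta> W 0 \<omega>"

  \<comment> \<open>The weak limit is recorded with its integral equation, since the limit in
    \<delta> compares these solutions path by path.\<close>
  define sol1 where "sol1 \<delta> \<epsilon> Y \<longleftrightarrow> continuous_process M Y \<and>
      (AE \<omega> in M. integral_solution b (L \<epsilon> \<omega>) q (?m \<delta> \<omega>) (\<lambda>t. Y t \<omega>)) \<and>
      (\<forall>T>0. weakly_converges (path_topology T) (\<lambda>\<mu>. path_law M T (Q \<mu> \<delta> \<epsilon>)) (path_law M T Y) (at_right 0))"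
    for \<delta> \<epsilon> Y
  have ex1: "\<exists>Y. sol1 \<delta> \<epsilon> Y" if \<delta>: "0 < \<delta>" and \<epsilon>: "\<epsilon> \<in> {0<..1}" for \<delta> \<epsilon>
    unfolding sol1_def
  proof (rule integral_solution_process_limit[OF P Qc[OF _ \<delta> \<epsilon>] c(1) L cL \<open>0 \<le> Kb\<close> lipb cb])
    fix I :: "nat \<Rightarrow> real" assume I: "\<And>n. 0 < I n" "I \<longlonglongrightarrow> 0"
    have "AE \<omega> in M. \<forall>n. langevin_solution (I n) b (\<lambda>x. lam (x / \<epsilon>) \<omega>)
        (deriv (\<lambda>t. mollified \<rho> \<delta> W t \<omega>)) q p (\<lambda>t. Q (I n) \<delta> \<epsilon> t \<omega>)"
      unfolding AE_all_countable by (intro allI Qsol I \<delta> \<epsilon>)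
    then show "AE \<omega> in M. \<exists>Fs. (\<forall>n. integral_solution b (L \<epsilon> \<omega>) q (Fs n) (\<lambda>t. Q (I n) \<delta> \<epsilon> t \<omega>)) \<and>
        (\<forall>T. uniform_limit {0..T} Fs (?m \<delta> \<omega>) sequentially)"
      using Wc AE_space
    proof eventually_elim
      case (elim \<omega>)
      show ?case
        by (rule langevin_approximation[where W=W and \<omega>=\<omega>, OF rho elim(2) \<delta> c(1) dL[OF _ elim(3)] _ B I])
          (use elim lbd \<epsilon> in auto)
    qed
  qed (use \<epsilon> in auto)
  \<comment> \<open>One process per pair of parameters, the same for all \<open>T\<close>, so that
    these form the family for the next limit.\<close>
  define Y1 where "Y1 \<delta> \<epsilon> = (SOME Y. sol1 \<delta> \<epsilon> Y)" for \<delta> \<epsilon>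
  have "sol1 \<delta> \<epsilon> (Y1 \<delta> \<epsilon>)" if "0 < \<delta>" "\<epsilon> \<in> {0<..1}" for \<delta> \<epsilon>
    unfolding Y1_def by (rule someI_ex[OF ex1[OF that]])
  then have Y1: "continuous_process M (Y1 \<delta> \<epsilon>)"
    "AE \<omega> in M. integral_solution b (L \<epsilon> \<omega>) q (?m \<delta> \<omega>) (\<lambda>t. Y1 \<delta> \<epsilon> t \<omega>)"
    "\<And>T. 0 < T \<Longrightarrow>
      weakly_converges (path_topology T) (\<lambda>\<mu>. path_law M T (Q \<mu> \<delta> \<epsilon>)) (path_law M T (Y1 \<delta> \<epsilon>)) (at_right 0)"
    if "0 < \<delta>" "\<epsilon> \<in> {0<..1}" for \<delta> \<epsilon>
    using that unfolding sol1_def by auto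

  define sol2 where "sol2 \<epsilon> Y \<longleftrightarrow> continuous_process M Y \<and>
      (AE \<omega> in M. integral_solution b (L \<epsilon> \<omega>) q (\<lambda>t. W t \<omega>) (\<lambda>t. Y t \<omega>)) \<and>
      (\<forall>T>0. weakly_converges (path_topology T) (\<lambda>\<delta>. path_law M T (Y1 \<delta> \<epsilon>)) (path_law M T Y) (at_right 0))"
    for \<epsilon> Y
  have ex2: "\<exists>Y. sol2 \<epsilon> Y" if \<epsilon>: "\<epsilon> \<in> {0<..1}" for \<epsilon>
    unfolding sol2_def
  proof (rule integral_solution_process_limit[OF P Y1(1)[OF _ \<epsilon>] c(1) L cL \<open>0 \<le> Kb\<close> lipb cb])
    fix I :: "nat \<Rightarrow> real" assume I: "\<And>n. 0 < I n" "I \<longlonglongrightarrow> 0"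
    have fI: "filterlim I (at_right 0) sequentially" 
      by (intro tendsto_imp_filterlim_at_right always_eventually allI I)
    have "AE \<omega> in M. \<forall>n. integral_solution b (L \<epsilon> \<omega>) q (?m (I n) \<omega>) (\<lambda>t. Y1 (I n) \<epsilon> t \<omega>)"
      unfolding AE_all_countable by (intro allI Y1 I \<epsilon>)
    then show "AE \<omega> in M. \<exists>Fs. (\<forall>n. integral_solution b (L \<epsilon> \<omega>) q (Fs n) (\<lambda>t. Y1 (I n) \<epsilon> t \<omega>)) \<and>
        (\<forall>T. uniform_limit {0..T} Fs (\<lambda>t. W t \<omega>) sequentially)"
      using Wc W0
    proof eventually_elim
      case (elim \<omega>)
      have lim: "uniform_limit {0..T} (\<lambda>n t. mollified \<rho> (I n) W t \<omega>) (\<lambda>t. W t \<omega>) sequentially" for T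
        by (rule filterlim_compose[OF mollified_tendsto[where W=W and \<omega>=\<omega>, OF rho elim(2)] fI])
      \<comment> \<open>The forcing is an increment from time 0; as \<open>W 0\<close> vanishes
        almost surely, its limit is the Wiener path itself.\<close>
      have "uniform_limit {0..T} (\<lambda>n. ?m (I n) \<omega>) (\<lambda>t. W t \<omega> - W 0 \<omega>) sequentially" for T
        using tendsto_uniform_limitI[OF lim[of 0], of 0]
        by (intro uniform_limit_minus lim) (simp add: uniform_limit_iff tendsto_iff)
      then show ?case using elim by (intro exI[of _ "\<lambda>n. ?m (I n) \<omega>"]) auto
    qed
  qed (use \<epsilon> in auto)
  define Y2 where "Y2 \<epsilon> = (SOME Y. sol2 \<epsilon> Y)" for \<epsilon>
  have "sol2 \<epsilon> (Y2 \<epsilon>)" if "\<epsilon> \<in> {0<..1}" for \<epsilon>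
    unfolding Y2_def by (rule someI_ex[OF ex2[OF that]])
  then have Y2: "continuous_process M (Y2 \<epsilon>)"
    "AE \<omega> in M. integral_solution b (L \<epsilon> \<omega>) q (\<lambda>t. W t \<omega>) (\<lambda>t. Y2 \<epsilon> t \<omega>)"
    "\<And>T. 0 < T \<Longrightarrow>
      weakly_converges (path_topology T) (\<lambda>\<delta>. path_law M T (Y1 \<delta> \<epsilon>)) (path_law M T (Y2 \<epsilon>)) (at_right 0)"
    if "\<epsilon> \<in> {0<..1}" for \<epsilon>
    using that unfolding sol2_def by auto

  have lim3: "weakly_converges (path_topology T) (\<lambda>\<epsilon>. path_law M T (Y2 \<epsilon>)) (path_law M T Qbar) (at_right 0)"
    if "0 < T" for T
  proof (rule integral_solution_weakly_converges[OF P that _ Y2(1) assms(9) c(1) _ \<open>0 \<le> Kb\<close> lipb cb])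
    show "at 0 within {0<..1} = at_right (0::real)"
      by (rule at_within_nhd[of _ "{..<1}"]) auto
    show "c * \<bar>x - y\<bar> \<le> \<bar>lbar * x - lbar * y\<bar>" for x y
      using c by (simp add: abs_mult right_diff_distrib[symmetric] mult_right_mono)
    show "AE \<omega> in M. integral_solution b (\<lambda>x. lbar * x) q (\<lambda>t. W t \<omega>) (\<lambda>t. Qbar t \<omega>)"
      using assms(10) AE_space
    proof eventually_elim
      case (elim \<omega>)
      have "continuous_on {0..} (\<lambda>t. Qbar t \<omega>)" using assms(9) elim by (simp add: continuous_process_def)
      moreover have "lbar * Qbar t \<omega> - lbar * q = integral {0..t} (\<lambda>s. b (Qbar s \<omega>)) + W t \<omega>" if "0 \<le> t" for t
      proof -
        have "Qbar t \<omega> = q + 1 / lbar * integral {0..t} (\<lambda>s. b (Qbar s \<omega>)) + 1 / lbar * W t \<omega>"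
          using elim(1) that unfolding averaged_solution_def by blast
        then show ?thesis using c by (simp add: field_simps)
      qed
      ultimately show ?case by (simp add: integral_solution_def)
    qed
    fix I :: "nat \<Rightarrow> real" assume I: "\<And>n. I n \<in> {0<..1} - {0}" "I \<longlonglongrightarrow> 0"
    have "AE \<omega> in M. \<forall>n. integral_solution b (L (I n) \<omega>) q (\<lambda>t. W t \<omega>) (\<lambda>t. Y2 (I n) t \<omega>)"
      unfolding AE_all_countable using I by (intro allI Y2) auto
    then show "AE \<omega> in M. \<exists>Fs. (\<forall>n. integral_solution b (\<lambda>x. lbar * x) q (Fs n) (\<lambda>t. Y2 (I n) t \<omega>)) \<and>
        (\<forall>T. uniform_limit {0..T} Fs (\<lambda>t. W t \<omega>) sequentially)"
      using Wc lln AE_space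
    proof eventually_elim
      case (elim \<omega>)
      \<comment> \<open>The null set of the law of large numbers is the same for all \<epsilon>,
        because it concerns the unscaled primitive.\<close>
      show ?case
      proof (rule homogenization_approximation[OF elim(2) c(1) d\<Lambda>[OF elim(4)]])
        show "\<Lambda> \<omega> 0 = 0" unfolding \<Lambda>_def by (rule primitive_0[OF lc[OF elim(4)]])
        show "((\<lambda>x. \<Lambda> \<omega> x / x) \<longlongrightarrow> lbar) at_infinity" using elim(3) by (simp add: \<Lambda>_def)
        show "integral_solution b (\<lambda>x. I n * \<Lambda> \<omega> (x / I n)) q (\<lambda>t. W t \<omega>) (\<lambda>t. Y2 (I n) t \<omega>)" for n
          using elim(1) by (simp add: L_def[abs_def])
        show "0 < I n" for n using I(1)[of n] by simp
      qed (use I lbd[OF elim(4)] B cb in auto)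
    qed
  qed auto
  show ?thesis
    unfolding iterated_weak_limit_def
  proof (intro allI impI exI conjI ballI)
    fix T :: real assume "0 < T"
    show "weakly_converges (path_topology T) (\<lambda>\<mu>. path_law M T (Q \<mu> \<delta> \<epsilon>)) (path_law M T (Y1 \<delta> \<epsilon>)) (at_right 0)"
      if "\<epsilon> \<in> {0<..1}" "0 < \<delta>" for \<epsilon> \<delta>
      by (rule Y1(3)[OF that(2,1) \<open>0 < T\<close>])
    show "weakly_converges (path_topology T) (\<lambda>\<delta>. path_law M T (Y1 \<delta> \<epsilon>)) (path_law M T (Y2 \<epsilon>)) (at_right 0)"
      if "\<epsilon> \<in> {0<..1}" for \<epsilon>
      by (rule Y2(3)[OF that \<open>0 < T\<close>])
    show "weakly_converges (path_topology T) (\<lambda>\<epsilon>. path_law M T (Y2 \<epsilon>)) (path_law M T Qbar) (at_right 0)"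
      by (rule lim3[OF \<open>0 < T\<close>])
  qed
qed

end
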